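(* For a poset $\mathcal{P}$ of integer pairs and $k\in\mathbb{Z}$, write $\sum_{i-j=k}$ for the sum over all $(i,j)\in\mathcal{P}$ with $i-j=k$ (empty sums are $0$); all parameters $k,i$ below are integers. (a) If $\mathcal{P}=[m]\times[n]$ with $m,n\ge2$, then each of the following collections is a basis of $I_T(\mathcal{P})$: $$\mathcal{B}_1=\Big\{\sum_{i-j=k}\mathcal{T}_{(i,j)} : 1-n\le k\le m-1,\ k\ne0\Big\}\cup\Big\{-1+\sum_{i-j=0}\mathcal{T}_{(i,j)}\Big\},$$ $$\mathcal{B}_2=\Big\{\sum_{i-j=k}\mathbf{1}_{(i,j)} : 1-n\le k\le m-1\Big\}.$$ (b) If $\mathcal{P}=([n]\times[n])\backslash\mathfrak{S}_2$ with $n\ge2$, then each of the following collections is a basis of $I_T(\mathcal{P})$: $$\mathcal{B}_1=\Big\{\sum_{i-j=k}\mathcal{T}_{(i,j)} : 1-n\le k<0\Big\}\cup\{\mathcal{T}_{(k,k)}:1<k\le n\}\cup\{\mathcal{T}_{(1,1)}-1\},$$ $$\mathcal{B}_2=\Big\{\sum_{i-j=k}\mathbf{1}_{(i,j)} : 1-n\le k<0\Big\}\cup\{2\cdot\mathbf{1}_{(i,i)}-\mathbf{1}_{(i-1,i)}-\mathbf{1}_{(i,i+1)}:1<i<n\}\cup\{2\cdot\mathbf{1}_{(1,1)}-\mathbf{1}_{(1,2)},\ 2\cdot\mathbf{1}_{(n,n)}-\mathbf{1}_{(n-1,n)}\}.$$ (c) If $\mathcal{P}=\Phi^+(A_n)$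 with $n\ge2$, then each of the following collections is a basis of $I_T(\mathcal{P})$: $$\mathcal{B}_1=\Big\{-1+\sum_{i-j=2k+1-n}\mathcal{T}_{(i,j)} : 0\le k\le n-1\Big\},$$ $$\mathcal{B}_2=\Big\{\sum_{i-j=2k+1-n}2\cdot\mathbf{1}_{(i,j)}-\sum_{i-j=2k+2-n}\mathbf{1}_{(i,j)}-\sum_{i-j=2k-n}\mathbf{1}_{(i,j)} : 0\le k\le n-1\Big\}.$$ (d) If $\mathcal{P}=\Phi^+(B_n)$ with $n\ge2$, then each of the following collections is a basis of $I_T(\mathcal{P})$: $$\mathcal{B}_1=\Big\{-1+\sum_{i-j=2k}\mathcal{T}_{(i,j)} : 0<k\le n-1\Big\}\cup\{\mathcal{T}_{(n,n)}-1\}\cup\{\mathcal{T}_{(i,i)}:n<i\le 2n-1\},$$ $$\mathcal{B}_2=\Big\{\sum_{i-j=2k}2\cdot\mathbf{1}_{(i,j)}-\sum_{i-j=2k-1}\mathbf{1}_{(i,j)}-\sum_{i-j=2k+1}\mathbf{1}_{(i,j)} : 0<k\le n-1\Big\}\cup\{2\cdot\mathbf{1}_{(k,k)}-\mathbf{1}_{(k,k-1)}-\mathbf{1}_{(k+1,k)}:n<k<2n-1\}$$ $$\cup\ \{2\cdot\mathbf{1}_{(2n-1,2n-1)}-\mathbf{1}_{(2n-1,2n-2)},\ 2\cdot\mathbf{1}_{(n,n)}-\mathbf{1}_{(n+1,n)}\}.$$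
   Context: For a finite poset $\mathcal{P}$, $\mathcal{J}(\mathcal{P})$ is the set of order ideals (down-closed subsets) of $\mathcal{P}$. For $p\in\mathcal{P}$ define real-valued functions on $\mathcal{J}(\mathcal{P})$: $\mathbf{1}_p(I)=1$ if $p\in I$ and $0$ otherwise; $\mathcal{T}_p^-(I)=1$ if $p$ is a maximal element of $I$ and $0$ otherwise; $\mathcal{T}_p^+(I)=1$ if $p\notin I$ and $I\cup\{p\}\in\mathcal{J}(\mathcal{P})$, and $0$ otherwise; $\mathcal{T}_p=\mathcal{T}_p^+-\mathcal{T}_p^-$. The order ideal toggleability space is the real vector space $I_T(\mathcal{P})=\mathrm{Span}_{\mathbb{R}}(\mathbf{1}_p\mid p\in\mathcal{P})\cap\mathrm{Span}_{\mathbb{R}}(\{1\}\cup\{\mathcal{T}_p\mid p\in\mathcal{P}\})$, where $1$ is the constant function. All four families are sets of integer pairs ordered componentwise ($(i,j)\preceq(k,\ell)$ iff $i\le k$ and $j\le\ell$): - $[m]\times[n]=\{(i,j): 1\le i\le m,\ 1\le j\le n\}$; - $([n]\times[n])\backslash\mathfrak{S}_2=\{(i,j):1\le i\le j\le n\}$; - $\Phi^+(A_n)=\{(i,j):1\le i,j\le n,\ i+j\ge n+1\}$; - $\Phi^+(B_n)=\{(i,j):1\le j\le i\le 2n-1,\ i+j\ge 2n\}$. *)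

theory Defs
  imports Complex_Main "HOL-Library.Function_Algebras" "HOL-Library.Product_Order"
begin

text \<open>Real-valued functions form a real vector space under pointwise operations; addition and
  subtraction are those of \<^theory>\<open>HOL-Library.Function_Algebras\<close>.\<close>

instantiation "fun" :: (type, real_vector) real_vector
begin

definition scaleR_fun :: "real \<Rightarrow> ('a \<Rightarrow> 'b) \<Rightarrow> 'a \<Rightarrow> 'b" where
  "scaleR_fun c f = (\<lambda>x. c *\<^sub>R f x)"

instance
  by standard (auto simp: scaleR_fun_def fun_eq_iff scaleR_add_right scaleR_add_left)

end

definition is_basis :: "'v::real_vector set \<Rightarrow> 'v set \<Rightarrow> bool" where
  "is_basis B V \<longleftrightarrow> independent B \<and> span B = V"

definition order_ideals :: "'a::order set \<Rightarrow> 'a set set" where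
  "order_ideals P = {I. I \<subseteq> P \<and> (\<forall>x\<in>I. \<forall>y\<in>P. y \<le> x \<longrightarrow> y \<in> I)}"

text \<open>A real-valued function on the order ideals of \<open>P\<close> is represented by its extension by zero
  to all sets. This identifies the space of such functions with a subspace of
  \<^typ>\<open>'a set \<Rightarrow> real\<close>; hence every function below, including the constant function, vanishes
  outside \<^term>\<open>order_ideals P\<close>.\<close>

definition const_one :: "'a::order set \<Rightarrow> 'a set \<Rightarrow> real" where
  "const_one P I = (if I \<in> order_ideals P then 1 else 0)"

definition ind :: "'a::order set \<Rightarrow> 'a \<Rightarrow> 'a set \<Rightarrow> real" where
  "ind P p I = (if I \<in> order_ideals P \<and> p \<in> I then 1 else 0)"

definition toggle_out :: "'a::order set \<Rightarrow> 'a \<Rightarrow> 'a set \<Rightarrow> real" where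
  "toggle_out P p I =
     (if I \<in> order_ideals P \<and> p \<in> I \<and> (\<forall>q\<in>I. p \<le> q \<longrightarrow> q = p) then 1 else 0)"

definition toggle_in :: "'a::order set \<Rightarrow> 'a \<Rightarrow> 'a set \<Rightarrow> real" where
  "toggle_in P p I =
     (if I \<in> order_ideals P \<and> p \<notin> I \<and> I \<union> {p} \<in> order_ideals P then 1 else 0)"

definition toggle :: "'a::order set \<Rightarrow> 'a \<Rightarrow> 'a set \<Rightarrow> real" where
  "toggle P p = toggle_in P p - toggle_out P p"

definition toggleability_space :: "'a::order set \<Rightarrow> ('a set \<Rightarrow> real) set" where
  "toggleability_space P =
     span {ind P p | p. p \<in> P} \<inter> span ({const_one P} \<union> {toggle P p | p. p \<in> P})"

text \<open>The order on \<^typ>\<open>int \<times> int\<close> is the componentwise order of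
  \<^theory>\<open>HOL-Library.Product_Order\<close>.\<close>

definition rectangle :: "int \<Rightarrow> int \<Rightarrow> (int \<times> int) set" where
  "rectangle m n = {(i, j). 1 \<le> i \<and> i \<le> m \<and> 1 \<le> j \<and> j \<le> n}"

definition shifted_staircase :: "int \<Rightarrow> (int \<times> int) set" where
  "shifted_staircase n = {(i, j). 1 \<le> i \<and> i \<le> j \<and> j \<le> n}"

definition root_poset_A :: "int \<Rightarrow> (int \<times> int) set" where
  "root_poset_A n = {(i, j). 1 \<le> i \<and> i \<le> n \<and> 1 \<le> j \<and> j \<le> n \<and> i + j \<ge> n + 1}"

definition root_poset_B :: "int \<Rightarrow> (int \<times> int) set" where
  "root_poset_B n = {(i, j). 1 \<le> j \<and> j \<le> i \<and> i \<le> 2 * n - 1 \<and> i + j \<ge> 2 * n}"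

definition diag_sum ::
    "(int \<times> int) set \<Rightarrow> int \<Rightarrow> (int \<times> int \<Rightarrow> 'v) \<Rightarrow> 'v::comm_monoid_add" where
  "diag_sum P k f = (\<Sum>(i, j) \<in> {(i, j). (i, j) \<in> P \<and> i - j = k}. f (i, j))"

end

theory Submission
  imports Defs
begin

text \<open>Comparing the values of a function on an order ideal and on the same ideal with one more
  element \<open>p\<close> turns membership in the span of the indicators into the condition that this
  increment depends on \<open>p\<close> only. For a combination \<open>\<Sum>q. b q * T q\<close> on a poset of integer pairs
  whose order is generated by unit steps, the increment at \<open>(i, j)\<close> is local, and the element
  \<open>(i + 1, j - 1)\<close> decides whether \<open>b (i + 1, j)\<close> or \<open>b (i, j - 1)\<close> contributes to it. Hence the
  condition says \<open>b (i + 1, j) = b (i, j - 1)\<close> whenever \<open>(i, j)\<close> and \<open>(i + 1, j - 1)\<close> lie in the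
  poset, where \<open>b\<close> is 0 outside the poset. Along each diagonal this makes \<open>b\<close> constant, or 0 for
  the diagonals of the wrong parity in the root posets, or leaves it free on the main diagonal of
  the shifted staircase and of the type B root poset. This shows that the toggle
  collection spans the toggleability space; it is independent because all toggle statistics are.
  Each of its members is a combination of the indicator collection, which has no more
  elements, so the latter is a basis as well.\<close>

section \<open>Spans of finite families and a counting criterion for bases\<close>

lemma sum_fun_apply: "(\<Sum>x\<in>A. f x) y = (\<Sum>x\<in>A. f x y)"
  by (induction A rule: infinite_finite_induct) auto

text \<open>The coefficients are indexed by \<open>A\<close> and not by the image of
  \<open>g\<close>, so that sums over a poset can be used directly, even where \<open>g\<close>
  repeats a value.\<close>

lemma span_image_finite:
  assumes "finite A"
  shows "span (g ` A) = range (\<lambda>u. \<Sum>x\<in>A. u x *\<^sub>R (g x :: 'v::real_vector))"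
proof (intro set_eqI iffI)
  fix f assume "f \<in> span (g ` A)"
  then show "f \<in> range (\<lambda>u. \<Sum>x\<in>A. u x *\<^sub>R g x)"
  proof (induction rule: span_induct_alt)
    case base
    show ?case by (intro range_eqI[of _ _ "\<lambda>_. 0"]) simp
  next
    case (step c v y)
    then obtain z u where z: "z \<in> A" "v = g z" and u: "y = (\<Sum>x\<in>A. u x *\<^sub>R g x)" by blast
    have "c *\<^sub>R v + y = (\<Sum>x\<in>A. (u x + (if x = z then c else 0)) *\<^sub>R g x)"
      using z assms by (simp add: u scaleR_left_distrib sum.distrib if_distrib[of "\<lambda>a. a *\<^sub>R _"]
          sum.delta cong: if_cong)
    then show ?case by (intro range_eqI[of _ _ "\<lambda>x. u x + (if x = z then c else 0)"])
  qed
qed (auto intro!: span_sum span_scale intro: span_base)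

text \<open>Triviality of all relations between the indexed vectors gives more than independence of
  their set: it also makes the indexing injective, which is what fixes the number of basis vectors
  later.\<close>

lemma independent_image_family:
  fixes v :: "'k \<Rightarrow> 'v::real_vector"
  assumes K: "finite K"
    and ind: "\<And>u k. (\<Sum>k\<in>K. u k *\<^sub>R v k) = 0 \<Longrightarrow> k \<in> K \<Longrightarrow> u k = 0"
  shows "inj_on v K" "independent (v ` K)"
proof -
  show inj: "inj_on v K"
  proof (rule inj_onI, rule ccontr)
    fix x y assume xy: "x \<in> K" "y \<in> K" "v x = v y" "x \<noteq> y"
    \<comment> \<open>Two equal vectors with different indices would satisfy the relation with
      coefficients 1 and -1.\<close>
    define u where "u k = (if k = x then 1 else 0) - (if k = y then 1 else 0 :: real)" for k
    have "(\<Sum>k\<in>K. u k *\<^sub>R v k) = v x - v y"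
      using xy K by (simp add: u_def scaleR_left_diff_distrib sum_subtractf
          if_distrib[of "\<lambda>a. a *\<^sub>R _"] sum.delta cong: if_cong)
    then have "u x = 0" using ind xy by simp
    then show False using xy by (simp add: u_def)
  qed
  show "independent (v ` K)"
  proof (rule independent_if_scalars_zero)
    fix f x assume "(\<Sum>x\<in>v ` K. f x *\<^sub>R x) = 0" "x \<in> v ` K"
    then show "f x = 0"
      using ind[of "\<lambda>k. f (v k)"] by (auto simp: sum.reindex[OF inj])
  qed (use K in simp)
qed

text \<open>Steinitz exchange, used twice. A vector of \<open>span B2\<close> outside
  \<open>span B1\<close> would enlarge \<open>B1\<close> to an independent set with more elements
  than \<open>B2\<close>. If \<open>B2\<close> were dependent, one of its members could be dropped
  without changing its span, and the rest would be too few to span the independent set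
  \<open>B1\<close>.\<close>

lemma is_basis_pair:
  fixes B1 B2 :: "'v::real_vector set"
  assumes ind: "independent B1" and B12: "B1 \<subseteq> span B2" and fin: "finite B2"
    and card: "card B2 \<le> card B1"
  shows "is_basis B1 (span B1)" "is_basis B2 (span B1)"
proof -
  show "is_basis B1 (span B1)" using ind by (simp add: is_basis_def)
  have "span B2 \<subseteq> span B1"
  proof (rule ccontr)
    assume "\<not> span B2 \<subseteq> span B1"
    then obtain x where x: "x \<in> span B2" "x \<notin> span B1" by blast
    then have "independent (insert x B1)" using ind by (simp add: independent_insert)
    moreover have "insert x B1 \<subseteq> span B2" using x B12 by simp
    ultimately have "finite (insert x B1) \<and> card (insert x B1) \<le> card B2"
      by (rule independent_span_bound[OF fin])
    moreover have "x \<notin> B1" using x span_base by blast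
    ultimately show False using card by auto
  qed
  then have eq: "span B2 = span B1"
    using B12 by (simp add: span_minimal subset_antisym)
  have "independent B2"
  proof
    assume "dependent B2"
    then obtain v where v: "v \<in> B2" "v \<in> span (B2 - {v})" by (auto simp: dependent_def)
    then have "span (B2 - {v}) = span B2"
      by (metis insert_Diff span_redundant)
    then have "card B1 \<le> card (B2 - {v})"
      using independent_span_bound[of "B2 - {v}" B1] ind B12 fin by simp
    with v fin card show False
      by (metis card_Diff1_less leD le_trans)
  qed
  with eq show "is_basis B2 (span B1)" by (simp add: is_basis_def)
qed

section \<open>Toggle statistics on order ideals and their independence\<close>

lemma finite_order_ideals: "finite P \<Longrightarrow> finite (order_ideals P)"
  by (rule finite_subset[of _ "Pow P"]) (auto simp: order_ideals_def)

lemma empty_order_ideal: "{} \<in> order_ideals P"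
  by (simp add: order_ideals_def)

lemma toggle_in_ideal:
  assumes "I \<in> order_ideals P" "q \<in> P"
  shows "toggle_in P q I = of_bool (q \<notin> I \<and> (\<forall>x\<in>P. x < q \<longrightarrow> x \<in> I))"
  using assms by (auto simp: toggle_in_def order_ideals_def less_le)

lemma toggle_out_ideal:
  assumes "I \<in> order_ideals P" "q \<in> P"
  shows "toggle_out P q I = of_bool (q \<in> I \<and> (\<forall>x\<in>I. \<not> q < x))"
  using assms by (auto simp: toggle_out_def less_le)

text \<open>Inserting \<open>q\<close> is a bijection from the ideals of \<open>A\<close> where
  \<open>q\<close> can be toggled in to those where it can be toggled out, because \<open>A\<close>
  is closed under toggling \<open>q\<close>. The values 1 and -1 therefore cancel in pairs.\<close>

lemma sum_toggle_eq_0: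
  assumes P: "finite P" and q: "q \<in> P"
    and A: "A \<subseteq> order_ideals P"
    and ins: "\<And>I. I \<in> A \<Longrightarrow> insert q I \<in> order_ideals P \<Longrightarrow> insert q I \<in> A"
    and rem: "\<And>I. I \<in> A \<Longrightarrow> I - {q} \<in> order_ideals P \<Longrightarrow> I - {q} \<in> A"
  shows "(\<Sum>I\<in>A. toggle P q I) = 0"
proof -
  have fin: "finite A" using A finite_order_ideals[OF P] finite_subset by blast
  have "(\<Sum>I\<in>A. toggle_in P q I) = (\<Sum>I\<in>{I\<in>A. toggle_in P q I \<noteq> 0}. toggle_in P q I)"
    using fin by (intro sum.mono_neutral_right) auto
  also have "\<dots> = (\<Sum>I\<in>{I\<in>A. toggle_out P q I \<noteq> 0}. toggle_out P q I)"
  proof (rule sum.reindex_bij_witness[where j = "insert q" and i = "\<lambda>I. I - {q}"])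
    fix I assume I: "I \<in> {I \<in> A. toggle_in P q I \<noteq> 0}"
    then have I': "q \<notin> I" "insert q I \<in> order_ideals P" "I \<in> order_ideals P" "I \<in> A"
      by (auto simp: toggle_in_def split: if_splits)
    then have o: "\<forall>x\<in>insert q I. q \<le> x \<longrightarrow> x = q"
      using q by (auto simp: order_ideals_def)
    show "insert q I - {q} = I" using I' by simp
    show "insert q I \<in> {I \<in> A. toggle_out P q I \<noteq> 0}"
      using I' o ins by (simp add: toggle_out_def)
    show "toggle_out P q (insert q I) = toggle_in P q I"
      using I' o by (simp add: toggle_out_def toggle_in_def)
  next
    fix I assume I: "I \<in> {I \<in> A. toggle_out P q I \<noteq> 0}"
    then have I': "q \<in> I" "I \<in> order_ideals P" "I \<in> A" "\<forall>x\<in>I. q \<le> x \<longrightarrow> x = q"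
      by (auto simp: toggle_out_def split: if_splits)
    then have o: "I - {q} \<in> order_ideals P"
      by (auto simp: order_ideals_def)
    show "insert q (I - {q}) = I" using I' by auto
    show "I - {q} \<in> {I \<in> A. toggle_in P q I \<noteq> 0}"
      using I' o rem by (simp add: toggle_in_def insert_absorb)
  qed
  also have "\<dots> = (\<Sum>I\<in>A. toggle_out P q I)"
    using fin by (intro sum.mono_neutral_left) auto
  finally show ?thesis by (simp add: toggle_def sum_subtractf)
qed

text \<open>Summing over all order ideals kills every toggle statistic; summing over the order ideals
  that contain \<open>p\<close> kills all of them except that of \<open>p\<close>.\<close>

lemma toggle_coefficients_unique:
  assumes P: "finite P" and eq: "c *\<^sub>R const_one P + (\<Sum>q\<in>P. b q *\<^sub>R toggle P q) = 0" and p: "p \<in> P"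
  shows "b p = 0"
proof -
  let ?J = "order_ideals P"
  note fin = finite_order_ideals[OF P]
  have ev: "c * const_one P I + (\<Sum>q\<in>P. b q * toggle P q I) = 0" for I
    using fun_cong[OF eq, of I] by (simp add: sum_fun_apply scaleR_fun_def)
  have tot: "(\<Sum>I\<in>A. c * const_one P I) + (\<Sum>q\<in>P. b q * (\<Sum>I\<in>A. toggle P q I)) = 0" for A
  proof -
    have "(\<Sum>I\<in>A. c * const_one P I) + (\<Sum>q\<in>P. b q * (\<Sum>I\<in>A. toggle P q I))
        = (\<Sum>I\<in>A. c * const_one P I + (\<Sum>q\<in>P. b q * toggle P q I))"
      unfolding sum.distrib sum_distrib_left by (subst sum.swap) simp
    then show ?thesis using ev by simp
  qed
  have "(\<Sum>I\<in>?J. toggle P q I) = 0" if "q \<in> P" for q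
    using that by (intro sum_toggle_eq_0[OF P]) auto
  then have "c * real (card ?J) = 0"
    using tot[of ?J] by (simp add: const_one_def mult.commute)
  then have c: "c = 0" using fin empty_order_ideal by fastforce
  let ?A = "{I \<in> ?J. p \<in> I}"
  have "(\<Sum>I\<in>?A. toggle P q I) = 0" if "q \<in> P" "q \<noteq> p" for q
    using that by (intro sum_toggle_eq_0[OF P]) auto
  then have "(\<Sum>q\<in>P. b q * (\<Sum>I\<in>?A. toggle P q I)) = b p * (\<Sum>I\<in>?A. toggle P p I)"
    using P p by (subst sum.remove[of _ p]) auto
  then have "b p * (\<Sum>I\<in>?A. toggle P p I) = 0"
    using tot[of ?A] c by simp
  \<comment> \<open>On ideals that contain \<open>p\<close> only the toggling-out part can be
    nonzero, and it is nonzero at the principal ideal of \<open>p\<close>.\<close>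
  moreover have "(\<Sum>I\<in>?A. toggle P p I) < 0"
  proof (rule sum_strict_mono_ex1[of _ _ "\<lambda>_. 0", simplified])
    show "\<forall>I\<in>?A. toggle P p I \<le> 0"
      by (auto simp: toggle_def toggle_in_def toggle_out_def)
    show "\<exists>I\<in>?A. toggle P p I < 0"
      using p by (intro bexI[of _ "{x\<in>P. x \<le> p}"])
        (auto simp: toggle_def toggle_in_def toggle_out_def order_ideals_def)
  qed (use fin in simp)
  ultimately show ?thesis by simp
qed

section \<open>Increments of toggle statistics\<close>

lemma order_ideal_downD: "I \<in> order_ideals P \<Longrightarrow> x \<in> I \<Longrightarrow> y \<in> P \<Longrightarrow> y \<le> x \<Longrightarrow> y \<in> I"
  by (auto simp: order_ideals_def)

lemma toggle_ideal:
  assumes "I \<in> order_ideals P" "q \<in> P"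
  shows "toggle P q I = of_bool (q \<notin> I \<and> (\<forall>x\<in>P. x < q \<longrightarrow> x \<in> I)) - of_bool (q \<in> I \<and> (\<forall>x\<in>I. \<not> q < x))"
  using assms by (simp add: toggle_def toggle_in_ideal toggle_out_ideal)

text \<open>This expresses that the order of \<open>P\<close> is generated by unit steps between
  members of \<open>P\<close>. It is stated as one step at either end of a strict comparison, so
  that covers can be analysed from below and from above without an induction along chains.\<close>

definition unit_step_poset :: "(int \<times> int) set \<Rightarrow> bool" where
  "unit_step_poset P \<longleftrightarrow> finite P \<and> (\<forall>(x, y)\<in>P. \<forall>(i, j)\<in>P. (x, y) < (i, j) \<longrightarrow>
     ((x + 1, y) \<in> P \<and> (x + 1, y) \<le> (i, j) \<or> (x, y + 1) \<in> P \<and> (x, y + 1) \<le> (i, j)) \<and>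
     ((i - 1, j) \<in> P \<and> (x, y) \<le> (i - 1, j) \<or> (i, j - 1) \<in> P \<and> (x, y) \<le> (i, j - 1)))"

lemma unit_step_up:
  assumes "unit_step_poset P" "(x, y) \<in> P" "q \<in> P" "(x, y) < q"
  shows "(x + 1, y) \<in> P \<and> (x + 1, y) \<le> q \<or> (x, y + 1) \<in> P \<and> (x, y + 1) \<le> q"
  using assms unfolding unit_step_poset_def by fastforce

lemma unit_step_down:
  assumes "unit_step_poset P" "q \<in> P" "(i, j) \<in> P" "q < (i, j)"
  shows "(i - 1, j) \<in> P \<and> q \<le> (i - 1, j) \<or> (i, j - 1) \<in> P \<and> q \<le> (i, j - 1)"
  using assms unfolding unit_step_poset_def by fastforce

text \<open>Only \<open>(i, j)\<close> and its four unit neighbours are affected. The statistic of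
  \<open>(i, j)\<close> itself drops from 1 to -1. An upper neighbour becomes insertable precisely
  when its other lower neighbour is in \<open>I\<close> or missing from \<open>P\<close>, a change
  from 0 to 1. A lower neighbour ceases to be maximal, a change from -1 to 0, precisely when its
  other upper neighbour is not in \<open>I\<close>. The corner \<open>(i + 1, j - 1)\<close> governs
  one upper and one lower neighbour, and \<open>(i - 1, j + 1)\<close> governs the other
  two.\<close>

lemma toggle_increment:
  assumes P: "unit_step_poset P"
    and I: "I \<in> order_ideals P" and J: "insert (i, j) I \<in> order_ideals P"
    and p: "(i, j) \<notin> I" and q: "q \<in> P"
  shows "toggle P q (insert (i, j) I) - toggle P q I =
      - 2 * of_bool (q = (i, j))
      + of_bool (q = (i + 1, j) \<and> ((i + 1, j - 1) \<in> P \<longrightarrow> (i + 1, j - 1) \<in> I))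
      + of_bool (q = (i, j - 1) \<and> (i + 1, j - 1) \<notin> I)
      + of_bool (q = (i, j + 1) \<and> ((i - 1, j + 1) \<in> P \<longrightarrow> (i - 1, j + 1) \<in> I))
      + of_bool (q = (i - 1, j) \<and> (i - 1, j + 1) \<notin> I)"
proof -
  have pP: "(i, j) \<in> P" and IP: "I \<subseteq> P" using I J by (auto simp: order_ideals_def)
  note down = order_ideal_downD[OF I]
  have notabove: "x \<notin> I" if "(i, j) \<le> x" for x using down pP that p by blast
  have below: "x \<in> I" if "x \<in> P" "x < (i, j)" for x
    using order_ideal_downD[OF J, of "(i, j)" x] that by (auto simp: less_le)
  note tog = toggle_ideal[OF I q] toggle_ideal[OF J q]
  consider "q = (i, j)" | "(i, j) < q" | "q < (i, j)" | "\<not> (i, j) \<le> q" "\<not> q \<le> (i, j)"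
    using order_le_imp_less_or_eq[of "(i, j)" q] order_le_imp_less_or_eq[of q "(i, j)"] by blast
  then show ?thesis
  proof cases
    case 1
    then show ?thesis using notabove below p unfolding tog by (auto simp: less_le)
  next
    case 2
    have qI: "q \<notin> I" using 2 notabove by auto
    have n: "q \<noteq> (i, j)" "q \<noteq> (i, j - 1)" "q \<noteq> (i - 1, j)" using 2 by (auto simp: less_le)
    have "(\<forall>x\<in>P. x < q \<longrightarrow> x \<in> insert (i, j) I) \<longleftrightarrow>
        q = (i + 1, j) \<and> ((i + 1, j - 1) \<in> P \<longrightarrow> (i + 1, j - 1) \<in> I) \<or>
        q = (i, j + 1) \<and> ((i - 1, j + 1) \<in> P \<longrightarrow> (i - 1, j + 1) \<in> I)" (is "?L \<longleftrightarrow> ?R")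
    proof
      assume L: ?L
      from unit_step_up[OF P pP q 2] show ?R
      proof (elim disjE conjE)
        assume a: "(i + 1, j) \<in> P" "(i + 1, j) \<le> q"
        have "(i + 1, j) \<notin> insert (i, j) I" using notabove[of "(i + 1, j)"] by simp
        then have "q = (i + 1, j)" using L a by (metis order_le_imp_less_or_eq)
        moreover have "(i + 1, j - 1) < (i + 1, j)" by (simp add: less_le)
        ultimately show ?R using L by auto
      next
        assume a: "(i, j + 1) \<in> P" "(i, j + 1) \<le> q"
        have "(i, j + 1) \<notin> insert (i, j) I" using notabove[of "(i, j + 1)"] by simp
        then have "q = (i, j + 1)" using L a by (metis order_le_imp_less_or_eq)
        moreover have "(i - 1, j + 1) < (i, j + 1)" by (simp add: less_le)
        ultimately show ?R using L by auto
      qed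
    next
      assume R: ?R
      show ?L
      proof (intro ballI impI)
        fix x assume x: "x \<in> P" "x < q"
        \<comment> \<open>A unit step down from \<open>q\<close> towards \<open>x\<close> shows that
          \<open>x\<close> is \<open>\<le>\<close> one of the two lower neighbours of
          \<open>q\<close> in \<open>P\<close>: one of them is \<open>(i, j)\<close>, and the other
          belongs to \<open>I\<close> by assumption.\<close>
        have "x \<in> insert (i, j) I" if "x \<le> (i, j)"
          using that below[of x] x order_le_imp_less_or_eq[of x "(i, j)"] by blast
        moreover have "x \<in> I" if "x \<le> r" "r \<in> I" for r using that down x by blast
        ultimately show "x \<in> insert (i, j) I"
          using R x q unit_step_down[OF P x(1), of "fst q" "snd q"] by auto blast+
      qed
    qed
    then have "toggle P q (insert (i, j) I) = of_bool ?R"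
      using qI n by (simp only: tog insert_iff) simp
    moreover have "toggle P q I = 0"
      using qI p 2 pP by (simp only: tog) auto
    moreover have "of_bool ?R =
        (of_bool (q = (i + 1, j) \<and> ((i + 1, j - 1) \<in> P \<longrightarrow> (i + 1, j - 1) \<in> I))
        + of_bool (q = (i, j + 1) \<and> ((i - 1, j + 1) \<in> P \<longrightarrow> (i - 1, j + 1) \<in> I)) :: real)"
      by (cases "q = (i + 1, j)") auto
    ultimately show ?thesis using n by simp
  next
    case 3
    have qI: "q \<in> I" using 3 below q by auto
    have n: "q \<noteq> (i, j)" "q \<noteq> (i, j + 1)" "q \<noteq> (i + 1, j)" using 3 by (auto simp: less_le)
    have maximal_iff: "(\<forall>x\<in>I. \<not> q < x) \<longleftrightarrow>
        q = (i, j - 1) \<and> (i + 1, j - 1) \<notin> I \<or> q = (i - 1, j) \<and> (i - 1, j + 1) \<notin> I" (is "?L \<longleftrightarrow> ?R")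
    proof
      assume L: ?L
      from unit_step_down[OF P q pP 3] show ?R
      proof (elim disjE conjE)
        assume a: "(i - 1, j) \<in> P" "q \<le> (i - 1, j)"
        have "(i - 1, j) \<in> I" using below a by (simp add: less_le)
        then have "q = (i - 1, j)" using L a by (metis order_le_imp_less_or_eq)
        moreover have "(i - 1, j) < (i - 1, j + 1)" by (simp add: less_le)
        ultimately show ?R using L by auto
      next
        assume a: "(i, j - 1) \<in> P" "q \<le> (i, j - 1)"
        have "(i, j - 1) \<in> I" using below a by (simp add: less_le)
        then have "q = (i, j - 1)" using L a by (metis order_le_imp_less_or_eq)
        moreover have "(i, j - 1) < (i + 1, j - 1)" by (simp add: less_le)
        ultimately show ?R using L by auto
      qed
    next
      assume R: ?R
      show ?L
      proof (intro ballI notI)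
        \<comment> \<open>A unit step up from \<open>q\<close> towards \<open>x\<close> would place
          an upper neighbour of \<open>q\<close> weakly below \<open>x\<close>, hence in
          \<open>I\<close>; but one of them is \<open>(i, j)\<close> and the other is outside
          \<open>I\<close> by assumption.\<close>
        fix x assume x: "x \<in> I" "q < x"
        then have "x \<in> P" using IP by auto
        moreover have "\<not> (i, j) \<le> x" using x notabove by blast
        moreover have "\<not> r \<le> x" if "r \<in> P" "r \<notin> I" for r using that down x by blast
        ultimately show False
          using R x q unit_step_up[OF P, of "fst q" "snd q" x] by auto
      qed
    qed
    have "toggle P q I = - of_bool ?R"
      by (simp only: tog maximal_iff) (simp add: qI)
    moreover have "toggle P q (insert (i, j) I) = 0"
      using qI 3 by (simp only: tog) auto
    moreover have "of_bool ?R =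
        (of_bool (q = (i, j - 1) \<and> (i + 1, j - 1) \<notin> I)
        + of_bool (q = (i - 1, j) \<and> (i - 1, j + 1) \<notin> I) :: real)"
      by (cases "q = (i - 1, j)") auto
    ultimately show ?thesis using n by simp
  next
    case 4
    have "(\<forall>x\<in>P. x < q \<longrightarrow> x \<in> insert (i, j) I) \<longleftrightarrow> (\<forall>x\<in>P. x < q \<longrightarrow> x \<in> I)"
      "(\<forall>x\<in>insert (i, j) I. \<not> q < x) \<longleftrightarrow> (\<forall>x\<in>I. \<not> q < x)" "q \<noteq> (i, j)"
      using 4 by auto
    moreover have "q \<noteq> (i + 1, j)" "q \<noteq> (i, j + 1)" "q \<noteq> (i - 1, j)" "q \<noteq> (i, j - 1)"
      using 4 by auto
    ultimately show ?thesis unfolding tog by simp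
  qed
qed

text \<open>Extending \<open>b\<close> by 0 makes neighbours outside \<open>P\<close> contribute
  nothing. If \<open>(i + 1, j - 1)\<close> lies in \<open>P\<close>, exactly one of
  \<open>b (i + 1, j)\<close> and \<open>b (i, j - 1)\<close> counts, depending on \<open>I\<close>;
  otherwise both count. The corner \<open>(i - 1, j + 1)\<close> acts in the same way on the other
  pair.\<close>

lemma toggle_sum_increment:
  assumes P: "unit_step_poset P"
    and I: "I \<in> order_ideals P" and J: "insert (i, j) I \<in> order_ideals P"
    and p: "(i, j) \<notin> I" and b0: "\<forall>q. q \<notin> P \<longrightarrow> b q = 0"
  shows "(\<Sum>q\<in>P. b q * toggle P q (insert (i, j) I)) - (\<Sum>q\<in>P. b q * toggle P q I) =
      - 2 * b (i, j)
      + (if (i + 1, j - 1) \<in> P \<longrightarrow> (i + 1, j - 1) \<in> I then b (i + 1, j) else 0)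
      + (if (i + 1, j - 1) \<notin> I then b (i, j - 1) else 0)
      + (if (i - 1, j + 1) \<in> P \<longrightarrow> (i - 1, j + 1) \<in> I then b (i, j + 1) else 0)
      + (if (i - 1, j + 1) \<notin> I then b (i - 1, j) else 0)"
proof -
  have fin: "finite P" using P by (simp add: unit_step_poset_def)
  have delta: "(\<Sum>q\<in>P. b q * of_bool (q = s \<and> A)) = (if A then b s else 0)" for s A
  proof -
    have "(\<Sum>q\<in>P. b q * of_bool (q = s \<and> A)) = (\<Sum>q\<in>P. if q = s then (if A then b q else 0) else 0)"
      by (intro sum.cong) auto
    also have "\<dots> = (if A then b s else 0)" using fin b0[rule_format, of s] by (subst sum.delta) auto
    finally show ?thesis .
  qed
  have "(\<Sum>q\<in>P. b q * toggle P q (insert (i, j) I)) - (\<Sum>q\<in>P. b q * toggle P q I)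
      = (\<Sum>q\<in>P. b q * (toggle P q (insert (i, j) I) - toggle P q I))"
    by (simp add: sum_subtractf right_diff_distrib)
  also have "\<dots> = (\<Sum>q\<in>P. - 2 * (b q * of_bool (q = (i, j) \<and> True))
      + b q * of_bool (q = (i + 1, j) \<and> ((i + 1, j - 1) \<in> P \<longrightarrow> (i + 1, j - 1) \<in> I))
      + b q * of_bool (q = (i, j - 1) \<and> (i + 1, j - 1) \<notin> I)
      + b q * of_bool (q = (i, j + 1) \<and> ((i - 1, j + 1) \<in> P \<longrightarrow> (i - 1, j + 1) \<in> I))
      + b q * of_bool (q = (i - 1, j) \<and> (i - 1, j + 1) \<notin> I))"
    by (intro sum.cong refl) (simp only: toggle_increment[OF P I J p], simp add: algebra_simps)
  also have "\<dots> = - 2 * b (i, j)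
      + (if (i + 1, j - 1) \<in> P \<longrightarrow> (i + 1, j - 1) \<in> I then b (i + 1, j) else 0)
      + (if (i + 1, j - 1) \<notin> I then b (i, j - 1) else 0)
      + (if (i - 1, j + 1) \<in> P \<longrightarrow> (i - 1, j + 1) \<in> I then b (i, j + 1) else 0)
      + (if (i - 1, j + 1) \<notin> I then b (i - 1, j) else 0)"
    unfolding sum.distrib sum_distrib_left[symmetric] delta by simp
  finally show ?thesis .
qed

lemma ind_increment:
  assumes "insert p I \<in> order_ideals P" "I \<in> order_ideals P" "p \<notin> I"
  shows "ind P q (insert p I) - ind P q I = of_bool (q = p)"
  using assms by (auto simp: ind_def)

text \<open>Only the indicator of \<open>p\<close> changes. The increment thus reads off the
  coefficient of \<open>p\<close> and is the same for every ideal \<open>I\<close>, which is the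
  property tested below.\<close>

lemma ind_sum_increment:
  assumes "finite P" "insert p I \<in> order_ideals P" "I \<in> order_ideals P" "p \<notin> I"
  shows "(\<Sum>q\<in>P. a q * ind P q (insert p I)) - (\<Sum>q\<in>P. a q * ind P q I) = a p"
proof -
  have "p \<in> P" using assms by (auto simp: order_ideals_def)
  have "(\<Sum>q\<in>P. a q * ind P q (insert p I)) - (\<Sum>q\<in>P. a q * ind P q I)
      = (\<Sum>q\<in>P. a q * (ind P q (insert p I) - ind P q I))"
    by (simp add: sum_subtractf right_diff_distrib)
  also have "\<dots> = (\<Sum>q\<in>P. if q = p then a q else 0)"
    by (intro sum.cong refl) (simp only: ind_increment[OF assms(2-4)], simp)
  finally show ?thesis using assms \<open>p \<in> P\<close> by (simp add: sum.delta)
qed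

text \<open>Removing a maximal element from a nonempty order ideal leaves an order ideal, so a
  function on ideals is determined by its value at the empty ideal and its increments.\<close>

lemma order_ideal_function_eqI:
  assumes P: "finite P"
    and out: "\<And>I. I \<notin> order_ideals P \<Longrightarrow> f I = g I"
    and empty: "f {} = g {}"
    and incr: "\<And>p I. I \<in> order_ideals P \<Longrightarrow> insert p I \<in> order_ideals P \<Longrightarrow> p \<notin> I \<Longrightarrow>
      f (insert p I) - f I = g (insert p I) - (g I :: real)"
  shows "f = g"
proof
  fix I
  show "f I = g I"
  proof (cases "I \<in> order_ideals P")
    case True
    then have "finite I" using P by (auto simp: order_ideals_def intro: finite_subset)
    then show ?thesis using True
    proof (induction I rule: finite_psubset_induct)
      case (psubset I)
      show ?case
      proof (cases "I = {}")
        case False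
        obtain p where p: "p \<in> I" "\<And>x. x \<in> I \<Longrightarrow> p \<le> x \<Longrightarrow> p = x"
          using finite_has_maximal[OF psubset.hyps(1) False] by blast
        have "I - {p} \<in> order_ideals P"
          using psubset.prems p by (auto simp: order_ideals_def)
        moreover from this have "f (I - {p}) = g (I - {p})"
          using p by (intro psubset.IH) auto
        ultimately show ?thesis
          using incr[of "I - {p}" p] p psubset.prems by (simp add: insert_absorb)
      qed (simp add: empty)
    qed
  qed (simp add: out)
qed

section \<open>Combinations of toggles in the span of the indicators\<close>

text \<open>The points \<open>(i, j)\<close> and \<open>(i + 1, j - 1)\<close> are the incomparable
  corners of a unit square with top \<open>(i + 1, j)\<close> and bottom \<open>(i, j - 1)\<close>.
  Top and bottom are consecutive points of one diagonal, and whenever both incomparable corners are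
  in \<open>P\<close> they must carry the same coefficient, which is 0 for a point outside
  \<open>P\<close>.\<close>

definition balanced :: "(int \<times> int) set \<Rightarrow> (int \<times> int \<Rightarrow> real) \<Rightarrow> bool" where
  "balanced P b \<longleftrightarrow> (\<forall>q. q \<notin> P \<longrightarrow> b q = 0) \<and>
     (\<forall>i j. (i, j) \<in> P \<longrightarrow> (i + 1, j - 1) \<in> P \<longrightarrow> b (i + 1, j) = b (i, j - 1))"

lemma balancedD: "balanced P b \<Longrightarrow> (i, j) \<in> P \<Longrightarrow> (i + 1, j - 1) \<in> P \<Longrightarrow> b (i + 1, j) = b (i, j - 1)"
  by (simp add: balanced_def)

lemma balanced_outside: "balanced P b \<Longrightarrow> q \<notin> P \<Longrightarrow> b q = 0"
  unfolding balanced_def by blast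

text \<open>The increment at \<open>(i, j)\<close> is computed over two ideals that differ only in
  \<open>(i + 1, j - 1)\<close>. Both results equal the indicator coefficient of
  \<open>(i, j)\<close>, and they differ only by exchanging \<open>b (i, j - 1)\<close> for
  \<open>b (i + 1, j)\<close>.\<close>

lemma toggle_span_balanced:
  assumes P: "unit_step_poset P" and b0: "\<forall>q. q \<notin> P \<longrightarrow> b q = 0"
    and mem: "c *\<^sub>R const_one P + (\<Sum>q\<in>P. b q *\<^sub>R toggle P q) \<in> span (ind P ` P)"
  shows "balanced P b"
  unfolding balanced_def
proof (intro conjI allI impI b0[rule_format])
  fix i j assume p: "(i, j) \<in> P" and r: "(i + 1, j - 1) \<in> P"
  have fin: "finite P" using P by (simp add: unit_step_poset_def)
  obtain a where "c *\<^sub>R const_one P + (\<Sum>q\<in>P. b q *\<^sub>R toggle P q) = (\<Sum>q\<in>P. a q *\<^sub>R ind P q)"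
    using mem unfolding span_image_finite[OF fin] by blast
  then have ev: "c * const_one P K + (\<Sum>q\<in>P. b q * toggle P q K) = (\<Sum>q\<in>P. a q * ind P q K)" for K
    by (auto dest!: fun_cong[of _ _ K] simp: sum_fun_apply scaleR_fun_def)
  \<comment> \<open>This is the largest ideal that avoids both incomparable corners. Either corner
    can be added to it, with or without the other.\<close>
  define I where "I = {x \<in> P. \<not> (i, j) \<le> x \<and> \<not> (i + 1, j - 1) \<le> x}"
  let ?p = "(i, j)" let ?r = "(i + 1, j - 1)"
  have ideals: "I \<in> order_ideals P" "insert ?p I \<in> order_ideals P"
    "insert ?r I \<in> order_ideals P" "insert ?p (insert ?r I) \<in> order_ideals P"
    using p r by (fastforce simp: order_ideals_def I_def)+
  have notin: "?p \<notin> I" "?p \<notin> insert ?r I" "?r \<notin> I"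
    by (auto simp: I_def)
  have incr: "(\<Sum>q\<in>P. b q * toggle P q (insert ?p K)) - (\<Sum>q\<in>P. b q * toggle P q K) = a ?p"
    if "K \<in> order_ideals P" "insert ?p K \<in> order_ideals P" "?p \<notin> K" for K
    using ev[of "insert ?p K"] ev[of K] that ind_sum_increment[OF fin that(2,1,3), of a]
    by (simp add: const_one_def)
  \<comment> \<open>The contribution of the square on the other side of \<open>(i, j)\<close>, which
    is unaffected by the presence of \<open>(i + 1, j - 1)\<close>.\<close>
  define A where "A = (if (i - 1, j + 1) \<in> P \<longrightarrow> (i - 1, j + 1) \<in> I then b (i, j + 1) else 0)
    + (if (i - 1, j + 1) \<notin> I then b (i - 1, j) else 0)"
  have s: "(i - 1, j + 1) \<in> insert ?r I \<longleftrightarrow> (i - 1, j + 1) \<in> I" by simp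
  have "a ?p = - 2 * b ?p + b (i, j - 1) + A"
    using toggle_sum_increment[OF P ideals(1,2) notin(1) b0, unfolded incr[OF ideals(1,2) notin(1)]]
    by (simp only: A_def r notin(3) simp_thms if_True if_False add_0_right add.assoc)
  moreover have "a ?p = - 2 * b ?p + b (i + 1, j) + A"
    using toggle_sum_increment[OF P ideals(3,4) notin(2) b0, unfolded incr[OF ideals(3,4) notin(2)]]
    by (simp only: A_def s r insertI1 simp_thms if_True if_False add_0_right add.assoc)
  ultimately show "b (i + 1, j) = b (i, j - 1)" by linarith
qed

text \<open>Converse of \<open>toggle_span_balanced\<close>, with explicit coefficients. Balance
  removes the dependence on \<open>I\<close> from the increment: for a corner in \<open>P\<close>
  the two alternatives agree and the upper one is recorded, for a missing corner both terms remain.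
  The constant \<open>c\<close> corrects the value at the empty ideal, where the indicators vanish
  and exactly the minimal elements have toggle statistic 1.\<close>

lemma toggle_sum_eq_ind_sum:
  assumes P: "unit_step_poset P" and bal: "balanced P b"
    and a: "\<And>i j. (i, j) \<in> P \<Longrightarrow> a (i, j) = - 2 * b (i, j)
        + (b (i + 1, j) + (if (i + 1, j - 1) \<in> P then 0 else b (i, j - 1)))
        + (b (i, j + 1) + (if (i - 1, j + 1) \<in> P then 0 else b (i - 1, j)))"
    and c: "c = - (\<Sum>q\<in>{q \<in> P. \<forall>x\<in>P. \<not> x < q}. b q)"
  shows "c *\<^sub>R const_one P + (\<Sum>q\<in>P. b q *\<^sub>R toggle P q) = (\<Sum>q\<in>P. a q *\<^sub>R ind P q)"
proof (rule order_ideal_function_eqI)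
  show fin: "finite P" using P by (simp add: unit_step_poset_def)
  show "(c *\<^sub>R const_one P + (\<Sum>q\<in>P. b q *\<^sub>R toggle P q)) I = (\<Sum>q\<in>P. a q *\<^sub>R ind P q) I"
    if "I \<notin> order_ideals P" for I
    using that by (simp add: sum_fun_apply scaleR_fun_def const_one_def toggle_def toggle_in_def
        toggle_out_def ind_def)
  have "(\<Sum>q\<in>P. b q * toggle P q {}) = (\<Sum>q\<in>P. if \<forall>x\<in>P. \<not> x < q then b q else 0)"
    by (intro sum.cong refl) (simp add: toggle_ideal empty_order_ideal)
  also have "\<dots> = - c" unfolding c by (simp add: sum.inter_filter[OF fin])
  finally show "(c *\<^sub>R const_one P + (\<Sum>q\<in>P. b q *\<^sub>R toggle P q)) {} = (\<Sum>q\<in>P. a q *\<^sub>R ind P q) {}"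
    by (simp add: sum_fun_apply scaleR_fun_def const_one_def ind_def empty_order_ideal)
  fix p I
  assume I: "I \<in> order_ideals P" "insert p I \<in> order_ideals P" "p \<notin> I"
  obtain i j where ij: "p = (i, j)" by fastforce
  have b0: "\<forall>q. q \<notin> P \<longrightarrow> b q = 0" using bal by (simp add: balanced_def)
  have pP: "(i, j) \<in> P" and IP: "I \<subseteq> P" using I ij by (auto simp: order_ideals_def)
  \<comment> \<open>Balance for the other square, whose incomparable corners are
    \<open>(i - 1, j + 1)\<close> and \<open>(i, j)\<close>.\<close>
  have "b (i, j + 1) = b (i - 1, j)" if "(i - 1, j + 1) \<in> P"
    using balancedD[OF bal, of "i - 1" "j + 1"] that pP by simp
  with balancedD[OF bal pP] a[OF pP] IP have
    "(\<Sum>q\<in>P. b q * toggle P q (insert (i, j) I)) - (\<Sum>q\<in>P. b q * toggle P q I) = a (i, j)"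
    unfolding toggle_sum_increment[OF P I[unfolded ij] b0] by auto
  then show "(c *\<^sub>R const_one P + (\<Sum>q\<in>P. b q *\<^sub>R toggle P q)) (insert p I)
        - (c *\<^sub>R const_one P + (\<Sum>q\<in>P. b q *\<^sub>R toggle P q)) I
      = (\<Sum>q\<in>P. a q *\<^sub>R ind P q) (insert p I) - (\<Sum>q\<in>P. a q *\<^sub>R ind P q) I"
    using ind_sum_increment[OF fin I(2,1,3), of a] I ij
    by (simp add: sum_fun_apply scaleR_fun_def const_one_def)
qed

lemma sum_of_bool_subset:
  assumes "finite P" "S \<subseteq> P"
  shows "(\<Sum>q\<in>P. of_bool (q \<in> S) *\<^sub>R f q) = (\<Sum>q\<in>S. f q :: 'v::real_vector)"
proof -
  have "(\<Sum>q\<in>P. of_bool (q \<in> S) *\<^sub>R f q) = (\<Sum>q\<in>P. if q \<in> S then f q else 0)"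
    by (intro sum.cong) auto
  then show ?thesis using assms by (simp add: sum.inter_restrict[symmetric] Int_absorb1)
qed

text \<open>The case where \<open>b\<close> is the characteristic function of \<open>S\<close>. The
  constant is then the number of minimal elements of \<open>P\<close> in \<open>S\<close>; the set
  \<open>M\<close> is a parameter so that each application can name these elements
  explicitly.\<close>

lemma toggle_subset_sum_eq_ind_sum:
  assumes P: "unit_step_poset P" and S: "S \<subseteq> P"
    and bal: "\<And>i j. (i, j) \<in> P \<Longrightarrow> (i + 1, j - 1) \<in> P \<Longrightarrow> (i + 1, j) \<in> S \<longleftrightarrow> (i, j - 1) \<in> S"
    and a: "\<And>i j. (i, j) \<in> P \<Longrightarrow> a (i, j) = - 2 * of_bool ((i, j) \<in> S)
        + (of_bool ((i + 1, j) \<in> S) + of_bool ((i + 1, j - 1) \<notin> P \<and> (i, j - 1) \<in> S))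
        + (of_bool ((i, j + 1) \<in> S) + of_bool ((i - 1, j + 1) \<notin> P \<and> (i - 1, j) \<in> S))"
    and d: "{q \<in> S. \<forall>x\<in>P. \<not> x < q} = M"
  shows "(\<Sum>q\<in>S. toggle P q) - real (card M) *\<^sub>R const_one P = (\<Sum>q\<in>P. a q *\<^sub>R ind P q)"
proof -
  have fin: "finite P" using P by (simp add: unit_step_poset_def)
  have card: "(\<Sum>q\<in>{q \<in> P. \<forall>x\<in>P. \<not> x < q}. of_bool (q \<in> S)) = real (card M)"
  proof -
    have "{q \<in> P. \<forall>x\<in>P. \<not> x < q} \<inter> {q. q \<in> S} = M" using d S by blast
    then show ?thesis using fin by simp
  qed
  have "(- real (card M)) *\<^sub>R const_one P + (\<Sum>q\<in>P. of_bool (q \<in> S) *\<^sub>R toggle P q)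
      = (\<Sum>q\<in>P. a q *\<^sub>R ind P q)"
  proof (rule toggle_sum_eq_ind_sum[OF P])
    show "balanced P (\<lambda>q. of_bool (q \<in> S))"
      unfolding balanced_def
    proof (intro conjI allI impI)
      fix i j assume "(i, j) \<in> P" "(i + 1, j - 1) \<in> P"
      then show "of_bool ((i + 1, j) \<in> S) = (of_bool ((i, j - 1) \<in> S) :: real)"
        by (simp only: bal)
    qed (use S in auto)
    fix i j assume "(i, j) \<in> P"
    then show "a (i, j) = - 2 * of_bool ((i, j) \<in> S)
        + (of_bool ((i + 1, j) \<in> S) + (if (i + 1, j - 1) \<in> P then 0 else of_bool ((i, j - 1) \<in> S)))
        + (of_bool ((i, j + 1) \<in> S) + (if (i - 1, j + 1) \<in> P then 0 else of_bool ((i - 1, j) \<in> S)))"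
      by (subst a) auto
  qed (simp add: card)
  then show ?thesis by (simp add: sum_of_bool_subset[OF fin S])
qed

lemma sum_scaleR_combination:
  fixes t :: "'p \<Rightarrow> 'v::real_vector"
  shows "(\<Sum>k\<in>K. u k *\<^sub>R ((\<Sum>p\<in>P. s k p *\<^sub>R t p) - d k *\<^sub>R e))
    = (\<Sum>p\<in>P. (\<Sum>k\<in>K. u k * s k p) *\<^sub>R t p) - (\<Sum>k\<in>K. u k * d k) *\<^sub>R e"
proof -
  have "(\<Sum>k\<in>K. u k *\<^sub>R ((\<Sum>p\<in>P. s k p *\<^sub>R t p) - d k *\<^sub>R e))
      = (\<Sum>k\<in>K. \<Sum>p\<in>P. (u k * s k p) *\<^sub>R t p) - (\<Sum>k\<in>K. (u k * d k) *\<^sub>R e)"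
    by (simp only: scaleR_diff_right sum_subtractf scaleR_sum_right scaleR_scaleR)
  then show ?thesis by (simp only: scaleR_left.sum sum.swap[of _ P K])
qed

section \<open>A criterion for two bases of the toggleability space\<close>

text \<open>The disjoint pieces \<open>S k\<close> carry the toggle collection. By
  \<open>const\<close> and \<open>zero\<close>, every balanced coefficient function is a combination
  of the characteristic functions of the pieces, so the \<open>v k\<close> span; they are
  independent because toggle coefficients are unique. As \<open>v\<close> and \<open>w\<close> share
  the index set, containment of each \<open>v k\<close> in the span of the \<open>w k\<close> is
  enough for the second basis.\<close>

lemma toggleability_space_bases:
  fixes v w :: "'k \<Rightarrow> (int \<times> int) set \<Rightarrow> real"
  assumes P: "unit_step_poset P" and K: "finite K"
    and S: "\<And>k. k \<in> K \<Longrightarrow> S k \<subseteq> P" "\<And>k. k \<in> K \<Longrightarrow> S k \<noteq> {}" "\<And>k l p. k \<in> K \<Longrightarrow> l \<in> K \<Longrightarrow> p \<in> S k \<Longrightarrow> p \<in> S l \<Longrightarrow> k = l"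
    and v: "\<And>k. k \<in> K \<Longrightarrow> v k = (\<Sum>q\<in>S k. toggle P q) - d k *\<^sub>R const_one P"
    and vw: "\<And>k. k \<in> K \<Longrightarrow> v k \<in> span (w ` K)"
    and w: "\<And>k. k \<in> K \<Longrightarrow> w k \<in> span (ind P ` P)"
    and const: "\<And>b k p q. balanced P b \<Longrightarrow> k \<in> K \<Longrightarrow> p \<in> S k \<Longrightarrow> q \<in> S k \<Longrightarrow> b p = b q"
    and zero: "\<And>b p. balanced P b \<Longrightarrow> p \<in> P \<Longrightarrow> \<forall>k\<in>K. p \<notin> S k \<Longrightarrow> b p = 0"
  shows "is_basis (v ` K) (toggleability_space P) \<and> is_basis (w ` K) (toggleability_space P)"
proof -
  have fin: "finite P" using P by (simp add: unit_step_poset_def)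
  let ?coef = "\<lambda>u p. \<Sum>k\<in>K. u k * of_bool (p \<in> S k)"
  have coef: "?coef u p = u k" if "k \<in> K" "p \<in> S k" for u :: "'k \<Rightarrow> real" and p k
  proof -
    have "?coef u p = (\<Sum>l\<in>K. if l = k then u l else 0)"
    proof (intro sum.cong refl)
      fix l assume "l \<in> K"
      with that have "p \<in> S l \<longleftrightarrow> l = k" using S(3) by blast
      then show "u l * of_bool (p \<in> S l) = (if l = k then u l else 0)" by simp
    qed
    then show ?thesis using K \<open>k \<in> K\<close> by (simp add: sum.delta)
  qed
  have expand: "(\<Sum>k\<in>K. u k *\<^sub>R v k)
      = (- (\<Sum>k\<in>K. u k * d k)) *\<^sub>R const_one P + (\<Sum>p\<in>P. ?coef u p *\<^sub>R toggle P p)" for u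
  proof -
    have "(\<Sum>k\<in>K. u k *\<^sub>R v k)
        = (\<Sum>k\<in>K. u k *\<^sub>R ((\<Sum>p\<in>P. of_bool (p \<in> S k) *\<^sub>R toggle P p) - d k *\<^sub>R const_one P))"
      by (intro sum.cong refl) (simp only: v sum_of_bool_subset[OF fin S(1)])
    also have "\<dots> = (\<Sum>p\<in>P. ?coef u p *\<^sub>R toggle P p) - (\<Sum>k\<in>K. u k * d k) *\<^sub>R const_one P"
      by (rule sum_scaleR_combination)
    finally show ?thesis by simp
  qed
  have v0: "u k = 0" if u: "(\<Sum>k\<in>K. u k *\<^sub>R v k) = 0" and k: "k \<in> K" for u k
  proof -
    obtain p where p: "p \<in> S k" using S(2)[OF k] by blast
    have "?coef u p = 0"
      using toggle_coefficients_unique[OF fin u[unfolded expand]] p S(1)[OF k] by blast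
    then show ?thesis using coef[OF k p] by simp
  qed
  have inj: "inj_on v K" and ind: "independent (v ` K)"
    by (rule independent_image_family[OF K, of v], rule v0, assumption+)+
  let ?X = "span (ind P ` P)"
  let ?T = "span (insert (const_one P) (toggle P ` P))"
  have V: "toggleability_space P = ?X \<inter> ?T"
    unfolding toggleability_space_def Setcompr_eq_image insert_is_Un[symmetric] ..
  have vX: "v ` K \<subseteq> ?X"
  proof -
    have "span (w ` K) \<subseteq> ?X" using w by (intro span_minimal subspace_span) blast
    then show ?thesis using vw by blast
  qed
  have vT: "v ` K \<subseteq> ?T"
  proof
    fix f assume "f \<in> v ` K"
    then obtain k where k: "k \<in> K" "f = (\<Sum>q\<in>S k. toggle P q) - d k *\<^sub>R const_one P"
      using v by blast
    have "toggle P q \<in> ?T" if "q \<in> S k" for q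
      using S(1)[OF k(1)] that by (intro span_base) blast
    then show "f \<in> ?T"
      unfolding k(2) by (intro span_diff span_sum span_scale) (auto intro: span_base)
  qed
  have "?X \<inter> ?T \<subseteq> span (v ` K)"
  proof
    fix f assume f: "f \<in> ?X \<inter> ?T"
    then obtain c where c: "f - c *\<^sub>R const_one P \<in> span (toggle P ` P)"
      by (auto simp: span_insert)
    then obtain b' where b': "f - c *\<^sub>R const_one P = (\<Sum>q\<in>P. b' q *\<^sub>R toggle P q)"
      unfolding span_image_finite[OF fin] by blast
    \<comment> \<open>Coefficients are cut off outside \<open>P\<close>, as \<open>balanced\<close>
      demands.\<close>
    define b where "b q = (if q \<in> P then b' q else 0)" for q
    have b0: "\<forall>q. q \<notin> P \<longrightarrow> b q = 0" by (simp add: b_def)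
    have fb: "f = c *\<^sub>R const_one P + (\<Sum>q\<in>P. b q *\<^sub>R toggle P q)"
      using b' by (simp add: b_def algebra_simps)
    then have bal: "balanced P b" using toggle_span_balanced[OF P b0] f by blast
    \<comment> \<open>The common value of \<open>b\<close> on the piece \<open>S k\<close>, read off
      at an arbitrary point.\<close>
    define u where "u k = b (SOME p. p \<in> S k)" for k
    have "?coef u p = b p" if "p \<in> P" for p
    proof (cases "\<exists>k\<in>K. p \<in> S k")
      case True
      then obtain k where k: "k \<in> K" "p \<in> S k" by blast
      have "u k = b p"
        unfolding u_def by (rule const[OF bal k(1) someI[of "\<lambda>p. p \<in> S k", OF k(2)] k(2)])
      then show ?thesis using coef[OF k, of u] by simp
    next
      case False
      then have "b p = 0" using zero[OF bal that] by blast
      then show ?thesis using False by simp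
    qed
    then have eq0: "f - (\<Sum>k\<in>K. u k *\<^sub>R v k) = (c + (\<Sum>k\<in>K. u k * d k)) *\<^sub>R const_one P"
      unfolding expand by (simp add: fb scaleR_left_distrib)
    moreover have "f - (\<Sum>k\<in>K. u k *\<^sub>R v k) \<in> ?X"
      using f vX by (intro span_diff span_sum span_scale) auto
    then obtain a where "f - (\<Sum>k\<in>K. u k *\<^sub>R v k) = (\<Sum>q\<in>P. a q *\<^sub>R ind P q)"
      unfolding span_image_finite[OF fin] by blast
    ultimately have eq: "(c + (\<Sum>k\<in>K. u k * d k)) *\<^sub>R const_one P = (\<Sum>q\<in>P. a q *\<^sub>R ind P q)"
      by simp
    \<comment> \<open>The remainder is a multiple of the constant function and lies in the indicator
      span. All indicators vanish at the empty ideal, so the multiple is 0.\<close>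
    have "c + (\<Sum>k\<in>K. u k * d k) = 0"
      using fun_cong[OF eq, of "{}"]
      by (simp add: sum_fun_apply scaleR_fun_def ind_def const_one_def empty_order_ideal)
    then have "f = (\<Sum>k\<in>K. u k *\<^sub>R v k)"
      using eq0 by simp
    moreover have "(\<Sum>k\<in>K. u k *\<^sub>R v k) \<in> span (v ` K)"
      by (intro span_sum span_scale span_base imageI)
    ultimately show "f \<in> span (v ` K)" by simp
  qed
  moreover have "span (v ` K) \<subseteq> ?X \<inter> ?T"
    by (intro Int_greatest span_minimal vX vT subspace_span)
  ultimately have eq: "span (v ` K) = toggleability_space P"
    unfolding V by (intro subset_antisym)
  have "card (w ` K) \<le> card (v ` K)"
    using card_image_le[OF K, of w] card_image[OF inj] by simp
  note pair = is_basis_pair[OF ind image_subsetI[OF vw] finite_imageI[OF K] this, unfolded eq]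
  show ?thesis by (intro conjI pair)
qed

section \<open>Sums over diagonals\<close>

lemma diag_sum_eq: "diag_sum P k f = (\<Sum>p\<in>{p \<in> P. fst p - snd p = k}. f p)"
proof -
  have "{(i, j). (i, j) \<in> P \<and> i - j = k} = {p \<in> P. fst p - snd p = k}" by auto
  then show ?thesis by (simp add: diag_sum_def case_prod_beta)
qed

lemma diag_sum_eq_0: "(\<And>p. p \<in> P \<Longrightarrow> fst p - snd p \<noteq> k) \<Longrightarrow> diag_sum P k f = 0"
  unfolding diag_sum_eq by (rule sum.neutral) blast

lemma diag_sum_scaleR: "diag_sum P k (\<lambda>p. c *\<^sub>R f p) = c *\<^sub>R diag_sum P k f" for f :: "_ \<Rightarrow> 'v::real_vector"
  by (simp add: diag_sum_eq scaleR_sum_right)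

text \<open>Order ideals are subsets of \<open>P\<close>. This convention lets boundary members of
  the indicator collections follow the same formula as the interior ones.\<close>

lemma ind_outside: "p \<notin> P \<Longrightarrow> ind P p = 0"
  by (auto simp: ind_def order_ideals_def fun_eq_iff)

lemma ind_in_span: "ind P p \<in> span (ind P ` P)"
  by (cases "p \<in> P") (auto simp: ind_outside span_zero intro: span_base)

lemma diag_sum_ind_in_span: "diag_sum P k (ind P) \<in> span (ind P ` P)"
  unfolding diag_sum_eq by (intro span_sum ind_in_span)

lemma sum_of_bool_eq_ind:
  assumes "finite P"
  shows "(\<Sum>q\<in>P. of_bool (q = s) *\<^sub>R ind P q) = ind P s"
proof (cases "s \<in> P")
  case True
  then show ?thesis using sum_of_bool_subset[OF assms, of "{s}" "ind P"] by simp
next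
  case False
  then have "(\<Sum>q\<in>P. of_bool (q = s) *\<^sub>R ind P q) = 0" by (intro sum.neutral) auto
  then show ?thesis using False by (simp add: ind_outside)
qed

lemma sum_of_bool_diag_ind:
  assumes "finite P"
  shows "(\<Sum>q\<in>P. of_bool (fst q - snd q = k) *\<^sub>R ind P q) = diag_sum P k (ind P)"
proof -
  have "(\<Sum>q\<in>P. of_bool (fst q - snd q = k) *\<^sub>R ind P q)
      = (\<Sum>q\<in>P. of_bool (q \<in> {p \<in> P. fst p - snd p = k}) *\<^sub>R ind P q)"
    by (intro sum.cong refl) simp
  also have "\<dots> = diag_sum P k (ind P)"
    unfolding diag_sum_eq by (rule sum_of_bool_subset) (use assms in auto)
  finally show ?thesis .
qed

text \<open>The parametrisation \<open>g\<close> may run past the ends of the diagonal, since points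
  outside \<open>P\<close> have zero indicator.\<close>

lemma diag_sum_ind_image:
  assumes "finite A" "inj_on g A" "{p \<in> P. fst p - snd p = k} = g ` A \<inter> P"
  shows "diag_sum P k (ind P) = (\<Sum>i\<in>A. ind P (g i))"
proof -
  have "(\<Sum>i\<in>A. ind P (g i)) = (\<Sum>q\<in>g ` A. ind P q)"
    by (simp add: sum.reindex[OF assms(2)])
  also have "\<dots> = (\<Sum>q\<in>g ` A \<inter> P. ind P q)"
    using assms(1) by (intro sum.mono_neutral_right) (auto simp: ind_outside)
  finally show ?thesis by (simp add: diag_sum_eq assms(3))
qed

text \<open>Up to a constant, the toggles of diagonal \<open>t\<close> give a discrete second
  difference of the diagonal indicator sums. The condition \<open>bal\<close> makes the diagonal
  balanced; \<open>lo\<close> and \<open>hi\<close> say that every point of an adjacent diagonal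
  receives exactly one contribution from diagonal \<open>t\<close>. The constant counts the minimal
  elements on the diagonal.\<close>

lemma diag_toggle_sum:
  assumes P: "unit_step_poset P"
    and bal: "\<And>i j. (i, j) \<in> P \<Longrightarrow> (i + 1, j - 1) \<in> P \<Longrightarrow> i + 1 - j = t \<Longrightarrow>
      (i + 1, j) \<in> P \<longleftrightarrow> (i, j - 1) \<in> P"
    and lo: "\<And>i j. (i, j) \<in> P \<Longrightarrow> i - j = t - 1 \<Longrightarrow>
      (i + 1, j) \<in> P \<longleftrightarrow> \<not> ((i + 1, j - 1) \<notin> P \<and> (i, j - 1) \<in> P)"
    and hi: "\<And>i j. (i, j) \<in> P \<Longrightarrow> i - j = t + 1 \<Longrightarrow>
      (i, j + 1) \<in> P \<longleftrightarrow> \<not> ((i - 1, j + 1) \<notin> P \<and> (i - 1, j) \<in> P)"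
    and M: "{q \<in> P. fst q - snd q = t \<and> (\<forall>x\<in>P. \<not> x < q)} = M"
  shows "diag_sum P t (toggle P) - real (card M) *\<^sub>R const_one P
    = diag_sum P (t - 1) (ind P) + diag_sum P (t + 1) (ind P) - 2 *\<^sub>R diag_sum P t (ind P)"
proof -
  have fin: "finite P" using P by (simp add: unit_step_poset_def)
  let ?S = "{p \<in> P. fst p - snd p = t}"
  let ?d = "\<lambda>k q. of_bool (fst q - snd q = k) :: real"
  have "(\<Sum>q\<in>?S. toggle P q) - real (card M) *\<^sub>R const_one P
      = (\<Sum>q\<in>P. (?d (t - 1) q + ?d (t + 1) q - 2 * ?d t q) *\<^sub>R ind P q)"
  proof (rule toggle_subset_sum_eq_ind_sum[OF P])
    show "{q \<in> ?S. \<forall>x\<in>P. \<not> x < q} = M" using M by blast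
  next
    fix i j assume p: "(i, j) \<in> P" and r: "(i + 1, j - 1) \<in> P"
    have "i + 1 - j = i - (j - 1)" by simp
    then show "(i + 1, j) \<in> ?S \<longleftrightarrow> (i, j - 1) \<in> ?S" using bal[OF p r] by auto
  next
    fix i j assume p: "(i, j) \<in> P"
    have 1: "of_bool ((i + 1, j) \<in> ?S) + of_bool ((i + 1, j - 1) \<notin> P \<and> (i, j - 1) \<in> ?S) = ?d (t - 1) (i, j)"
    proof (cases "i - j = t - 1")
      case True
      then show ?thesis using lo[OF p True] by (cases "(i + 1, j) \<in> P") auto
    qed auto
    have 2: "of_bool ((i, j + 1) \<in> ?S) + of_bool ((i - 1, j + 1) \<notin> P \<and> (i - 1, j) \<in> ?S) = ?d (t + 1) (i, j)"
    proof (cases "i - j = t + 1")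
      case True
      then show ?thesis using hi[OF p True] by (cases "(i, j + 1) \<in> P") auto
    qed auto
    show "?d (t - 1) (i, j) + ?d (t + 1) (i, j) - 2 * ?d t (i, j) = - 2 * of_bool ((i, j) \<in> ?S)
        + (of_bool ((i + 1, j) \<in> ?S) + of_bool ((i + 1, j - 1) \<notin> P \<and> (i, j - 1) \<in> ?S))
        + (of_bool ((i, j + 1) \<in> ?S) + of_bool ((i - 1, j + 1) \<notin> P \<and> (i - 1, j) \<in> ?S))"
      unfolding 1 2 using p by simp
  qed blast
  also have "\<dots> = (\<Sum>q\<in>P. ?d (t - 1) q *\<^sub>R ind P q) + (\<Sum>q\<in>P. ?d (t + 1) q *\<^sub>R ind P q)
      - 2 *\<^sub>R (\<Sum>q\<in>P. ?d t q *\<^sub>R ind P q)"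
    by (simp only: scaleR_diff_left scaleR_left_distrib sum_subtractf sum.distrib scaleR_sum_right
        scaleR_scaleR)
  finally show ?thesis by (simp only: sum_of_bool_diag_ind[OF fin] diag_sum_eq[of P t "toggle P"])
qed

section \<open>Balanced coefficients along a diagonal\<close>

text \<open>By \<open>conv\<close>, each step between consecutive points of the diagonal crosses a
  unit square whose incomparable corners lie in \<open>P\<close>, so balance carries the value of
  \<open>b\<close> along.\<close>

lemma balanced_diag_constant:
  assumes bal: "balanced P b"
    and conv: "\<And>x y n. (x, y) \<in> P \<Longrightarrow> (x + n, y + n) \<in> P \<Longrightarrow> x - y = t \<Longrightarrow> 0 < n \<Longrightarrow>
      (x + n - 1, y + n - 1) \<in> P \<and> (x + n - 1, y + n) \<in> P \<and> (x + n, y + n - 1) \<in> P"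
    and p: "p \<in> P" "fst p - snd p = t" and q: "q \<in> P" "fst q - snd q = t"
  shows "b p = b q"
proof -
  have step: "b (x, y) = b (x + int n, y + int n)"
    if "(x, y) \<in> P" "x - y = t" "(x + int n, y + int n) \<in> P" for x y n
    using that(3)
  proof (induction n)
    case (Suc n)
    have c: "(x + int n, y + int n) \<in> P" "(x + int n, y + int n + 1) \<in> P" "(x + int n + 1, y + int n) \<in> P"
      using conv[OF that(1) Suc.prems that(2)] by (simp_all add: algebra_simps)
    then have "b (x + int n + 1, y + int n + 1) = b (x + int n, y + int n)"
      using balancedD[OF bal c(2)] by simp
    then show ?case using Suc.IH[OF c(1)] by (simp add: algebra_simps)
  qed simp
  have le: "b p = b q" if "fst p \<le> fst q" "p \<in> P" "fst p - snd p = t" "q \<in> P" "fst q - snd q = t" for p q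
    using step[of "fst p" "snd p" "nat (fst q - fst p)"] that
    by (cases p; cases q) (simp add: algebra_simps)
  show ?thesis using le[of p q] le[of q p] p q by linarith
qed

text \<open>On a diagonal of the wrong parity each point has both lower neighbours in
  \<open>P\<close>, so balance moves the value one step down the diagonal, with the parity of
  \<open>i + j\<close> preserved. The descent must leave \<open>P\<close>, where \<open>b\<close> is
  0; positivity of \<open>i + j\<close> makes the measure decrease.\<close>

lemma balanced_eq_0:
  assumes bal: "balanced P b"
    and pos: "\<And>i j. (i, j) \<in> P \<Longrightarrow> 0 < i + j"
    and low: "\<And>i j. (i, j) \<in> P \<Longrightarrow> odd (i + j + s) \<Longrightarrow> (i - 1, j) \<in> P \<and> (i, j - 1) \<in> P"
    and p: "(i, j) \<in> P" "odd (i + j + s)"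
  shows "b (i, j) = 0"
  using p
proof (induction "nat (i + j)" arbitrary: i j rule: less_induct)
  case less
  have "b (i, j) = b (i - 1, j - 1)"
    using balancedD[OF bal, of "i - 1" j] low[OF less.prems] by simp
  moreover have "b (i - 1, j - 1) = 0"
  proof (cases "(i - 1, j - 1) \<in> P")
    case True
    have "odd (i - 1 + (j - 1) + s)" using less.prems(2) by presburger
    then show ?thesis using less.hyps[OF _ True] pos[OF less.prems(1)] pos[OF True] by simp
  qed (rule balanced_outside[OF bal])
  ultimately show ?case by simp
qed

section \<open>Generation of the four orders by unit steps\<close>

lemma unit_step_rectangle: "unit_step_poset (rectangle m n)"
proof -
  have "finite (rectangle m n)"
    by (rule finite_subset[of _ "{1..m} \<times> {1..n}"]) (auto simp: rectangle_def)
  then show ?thesis by (auto simp: unit_step_poset_def rectangle_def less_le)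
qed

lemma unit_step_shifted_staircase: "unit_step_poset (shifted_staircase n)"
proof -
  have "finite (shifted_staircase n)"
    by (rule finite_subset[of _ "{1..n} \<times> {1..n}"]) (auto simp: shifted_staircase_def)
  then show ?thesis by (auto simp: unit_step_poset_def shifted_staircase_def less_le)
qed

lemma unit_step_root_poset_A: "unit_step_poset (root_poset_A n)"
proof -
  have "finite (root_poset_A n)"
    by (rule finite_subset[of _ "{1..n} \<times> {1..n}"]) (auto simp: root_poset_A_def)
  then show ?thesis by (auto simp: unit_step_poset_def root_poset_A_def less_le)
qed

lemma unit_step_root_poset_B: "unit_step_poset (root_poset_B n)"
proof -
  have "finite (root_poset_B n)"
    by (rule finite_subset[of _ "{1..2 * n - 1} \<times> {1..2 * n - 1}"]) (auto simp: root_poset_B_def)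
  then show ?thesis by (auto simp: unit_step_poset_def root_poset_B_def less_le)
qed

section \<open>The four families\<close>

lemma minimal_iff_least:
  assumes "a \<in> P" "\<And>x. x \<in> P \<Longrightarrow> a \<le> x" "q \<in> P"
  shows "(\<forall>x\<in>P. \<not> x < q) \<longleftrightarrow> q = (a :: 'a::order)"
  using assms by (auto simp: less_le intro: order.antisym)

text \<open>Above the antidiagonal \<open>i + j = n + 1\<close> the bound \<open>i \<le> n\<close>
  forces \<open>j \<ge> 2\<close>, so the second coordinate can still be lowered.\<close>

lemma minimal_root_poset_A:
  assumes "(i, j) \<in> root_poset_A n"
  shows "(\<forall>x\<in>root_poset_A n. \<not> x < (i, j)) \<longleftrightarrow> i + j = n + 1"
proof
  assume min: "\<forall>x\<in>root_poset_A n. \<not> x < (i, j)"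
  have "(i, j - 1) < (i, j)" "(i - 1, j) < (i, j)" by (simp_all add: less_le)
  then have "(i, j - 1) \<notin> root_poset_A n" "(i - 1, j) \<notin> root_poset_A n" using min by blast+
  then show "i + j = n + 1" using assms by (auto simp: root_poset_A_def)
next
  assume "i + j = n + 1"
  then show "\<forall>x\<in>root_poset_A n. \<not> x < (i, j)" by (auto simp: root_poset_A_def less_le)
qed

text \<open>As in type A: \<open>i + j > 2 * n\<close> and \<open>i \<le> 2 * n - 1\<close> force
  \<open>j \<ge> 2\<close>, and lowering \<open>j\<close> respects \<open>j \<le> i\<close>.\<close>

lemma minimal_root_poset_B:
  assumes "(i, j) \<in> root_poset_B n"
  shows "(\<forall>x\<in>root_poset_B n. \<not> x < (i, j)) \<longleftrightarrow> i + j = 2 * n"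
proof
  assume min: "\<forall>x\<in>root_poset_B n. \<not> x < (i, j)"
  have "(i, j - 1) < (i, j)" "(i - 1, j) < (i, j)" by (simp_all add: less_le)
  then have "(i, j - 1) \<notin> root_poset_B n" "(i - 1, j) \<notin> root_poset_B n" using min by blast+
  then show "i + j = 2 * n" using assms by (auto simp: root_poset_B_def)
next
  assume "i + j = 2 * n"
  then show "\<forall>x\<in>root_poset_B n. \<not> x < (i, j)" by (auto simp: root_poset_B_def less_le)
qed

section \<open>The rectangle\<close>

text \<open>The only minimal element \<open>(1, 1)\<close> lies on diagonal 0, so the constant
  appears only there.\<close>

lemma diag_toggle_sum_rectangle:
  assumes "2 \<le> m" "2 \<le> n" "1 - n \<le> t" "t \<le> m - 1"
  shows "diag_sum (rectangle m n) t (toggle (rectangle m n)) - of_bool (t = 0) *\<^sub>R const_one (rectangle m n)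
    = diag_sum (rectangle m n) (t - 1) (ind (rectangle m n))
      + diag_sum (rectangle m n) (t + 1) (ind (rectangle m n))
      - 2 *\<^sub>R diag_sum (rectangle m n) t (ind (rectangle m n))"
proof -
  let ?P = "rectangle m n"
  have "{q \<in> ?P. fst q - snd q = t \<and> (\<forall>x\<in>?P. \<not> x < q)} = (if t = 0 then {(1, 1)} else {})"
  proof -
    have "(\<forall>x\<in>?P. \<not> x < q) \<longleftrightarrow> q = (1, 1)" if "q \<in> ?P" for q
      by (rule minimal_iff_least) (use assms that in \<open>auto simp: rectangle_def\<close>)
    then have "{q \<in> ?P. fst q - snd q = t \<and> (\<forall>x\<in>?P. \<not> x < q)}
        = {q \<in> ?P. fst q - snd q = t \<and> q = (1, 1)}" by blast
    also have "\<dots> = (if t = 0 then {(1, 1)} else {})" using assms by (auto simp: rectangle_def)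
    finally show ?thesis .
  qed
  note M = this
  have c: "real (card (if t = 0 then {(1 :: int, 1 :: int)} else {})) = of_bool (t = 0)" by simp
  show ?thesis
    \<comment> \<open>The bounds on \<open>t\<close> matter at the far edges: a point of diagonal
      \<open>t - 1\<close> with \<open>i = m\<close> has \<open>j \<ge> 2\<close>, and a point of
      diagonal \<open>t + 1\<close> with \<open>j = n\<close> has \<open>i \<ge> 2\<close>.\<close>
    by (rule diag_toggle_sum[OF unit_step_rectangle _ _ _ M, unfolded c])
      (use assms in \<open>auto simp: rectangle_def\<close>)
qed

lemma toggleability_bases_rectangle:
  assumes mn: "2 \<le> m" "2 \<le> n"
  defines "P \<equiv> rectangle m n"
  shows "is_basis
      ({diag_sum P k (toggle P) | k. 1 - n \<le> k \<and> k \<le> m - 1 \<and> k \<noteq> 0} \<union> {- const_one P + diag_sum P 0 (toggle P)})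
      (toggleability_space P)"
    and "is_basis {diag_sum P k (ind P) | k. 1 - n \<le> k \<and> k \<le> m - 1} (toggleability_space P)"
proof -
  define K where "K = {1 - n..m - 1}"
  define S where "S k = {p \<in> P. fst p - snd p = k}" for k
  define v where "v k = diag_sum P k (toggle P) - of_bool (k = 0) *\<^sub>R const_one P" for k
  define w where "w k = diag_sum P k (ind P)" for k
  have V: "v ` K = {diag_sum P k (toggle P) | k. 1 - n \<le> k \<and> k \<le> m - 1 \<and> k \<noteq> 0} \<union> {- const_one P + diag_sum P 0 (toggle P)}"
  proof -
    have "K = {k. 1 - n \<le> k \<and> k \<le> m - 1 \<and> k \<noteq> 0} \<union> {0}" using mn by (auto simp: K_def)
    moreover have "v ` {k. 1 - n \<le> k \<and> k \<le> m - 1 \<and> k \<noteq> 0}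
        = {diag_sum P k (toggle P) | k. 1 - n \<le> k \<and> k \<le> m - 1 \<and> k \<noteq> 0}"
      by (force simp: v_def)
    ultimately show ?thesis by (simp only: image_Un) (simp add: v_def)
  qed
  have W: "w ` K = {diag_sum P k (ind P) | k. 1 - n \<le> k \<and> k \<le> m - 1}"
    by (auto simp: w_def K_def)
  \<comment> \<open>The second difference at the extreme diagonals refers to the empty diagonals
    just outside the range, which contribute 0.\<close>
  have diag: "diag_sum P k (ind P) \<in> span (w ` K)" for k
  proof (cases "k \<in> K")
    case True
    then show ?thesis by (auto simp: w_def intro: span_base)
  next
    case False
    then have "diag_sum P k (ind P) = 0"
      by (intro diag_sum_eq_0) (auto simp: P_def rectangle_def K_def)
    then show ?thesis by (simp add: span_zero)
  qed
  have "is_basis (v ` K) (toggleability_space P) \<and> is_basis (w ` K) (toggleability_space P)"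
  proof (rule toggleability_space_bases)
    show "unit_step_poset P" by (simp add: P_def unit_step_rectangle)
    show "finite K" by (simp add: K_def)
  next
    fix k assume "k \<in> K"
    then have k: "1 - n \<le> k" "k \<le> m - 1" by (simp_all add: K_def)
    then have "(if k \<ge> 0 then (k + 1, 1) else (1, 1 - k)) \<in> S k"
      using mn by (auto simp: S_def P_def rectangle_def)
    then show "S k \<noteq> {}" by blast
    show "v k \<in> span (w ` K)"
      unfolding v_def diag_toggle_sum_rectangle[OF mn k, folded P_def]
      by (intro span_diff span_add span_scale diag)
    show "v k = (\<Sum>q\<in>S k. toggle P q) - of_bool (k = 0) *\<^sub>R const_one P"
      by (simp add: v_def diag_sum_eq S_def)
    show "w k \<in> span (ind P ` P)" by (simp add: w_def diag_sum_ind_in_span)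
  next
    fix b k p q assume bal: "balanced P b" and "k \<in> K" "p \<in> S k" "q \<in> S k"
    then have "p \<in> P" "fst p - snd p = k" "q \<in> P" "fst q - snd q = k" by (auto simp: S_def)
    then show "b p = b q"
      by (rule balanced_diag_constant[OF bal, rotated]) (auto simp: P_def rectangle_def)
  next
    fix b p assume "p \<in> P" "\<forall>k\<in>K. p \<notin> S k"
    then show "b p = (0::real)" by (auto simp: S_def K_def P_def rectangle_def)
  qed (auto simp: S_def)
  then show "is_basis
      ({diag_sum P k (toggle P) | k. 1 - n \<le> k \<and> k \<le> m - 1 \<and> k \<noteq> 0} \<union> {- const_one P + diag_sum P 0 (toggle P)})
      (toggleability_space P)"
    "is_basis {diag_sum P k (ind P) | k. 1 - n \<le> k \<and> k \<le> m - 1} (toggleability_space P)"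
    unfolding V W by blast+
qed

section \<open>The shifted staircase\<close>

text \<open>The only minimal element \<open>(1, 1)\<close> is on the main diagonal, so no constant
  occurs for \<open>t < 0\<close>.\<close>

lemma diag_toggle_sum_shifted_staircase:
  assumes "2 \<le> n" "1 - n \<le> t" "t < 0"
  defines "P \<equiv> shifted_staircase n"
  shows "diag_sum P t (toggle P)
    = diag_sum P (t - 1) (ind P) + diag_sum P (t + 1) (ind P) - 2 *\<^sub>R diag_sum P t (ind P)"
proof -
  have "(\<forall>x\<in>P. \<not> x < q) \<longleftrightarrow> q = (1, 1)" if "q \<in> P" for q
    by (rule minimal_iff_least) (use assms that in \<open>auto simp: P_def shifted_staircase_def\<close>)
  then have "{q \<in> P. fst q - snd q = t \<and> (\<forall>x\<in>P. \<not> x < q)}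
      = {q \<in> P. fst q - snd q = t \<and> q = (1, 1)}" by blast
  then have M: "{q \<in> P. fst q - snd q = t \<and> (\<forall>x\<in>P. \<not> x < q)} = {}" using assms by auto
  have "diag_sum P t (toggle P) - real (card ({} :: (int \<times> int) set)) *\<^sub>R const_one P
    = diag_sum P (t - 1) (ind P) + diag_sum P (t + 1) (ind P) - 2 *\<^sub>R diag_sum P t (ind P)"
    by (rule diag_toggle_sum[OF unit_step_shifted_staircase[of n, folded P_def] _ _ _ M])
      (use assms(1-3) in \<open>auto simp: P_def shifted_staircase_def\<close>)
  then show ?thesis by simp
qed

text \<open>A single main diagonal toggle is already balanced: a square between consecutive diagonal
  points has a corner \<open>(i + 1, i)\<close> outside the staircase, so nothing ties these points
  together. The same missing corners give both \<open>(k - 1, k)\<close> and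
  \<open>(k, k + 1)\<close> the coefficient 1.\<close>

lemma toggle_diagonal_shifted_staircase:
  assumes "2 \<le> n" "1 \<le> k" "k \<le> n"
  defines "P \<equiv> shifted_staircase n"
  shows "toggle P (k, k) - of_bool (k = 1) *\<^sub>R const_one P
    = ind P (k - 1, k) + ind P (k, k + 1) - 2 *\<^sub>R ind P (k, k)"
proof -
  have P: "unit_step_poset P" by (simp add: P_def unit_step_shifted_staircase)
  then have fin: "finite P" by (simp add: unit_step_poset_def)
  have "(\<forall>x\<in>P. \<not> x < q) \<longleftrightarrow> q = (1, 1)" if "q \<in> P" for q
    by (rule minimal_iff_least) (use assms that in \<open>auto simp: P_def shifted_staircase_def\<close>)
  moreover have kP: "{(k, k)} \<subseteq> P" using assms by (auto simp: P_def shifted_staircase_def)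
  ultimately have M: "{q \<in> {(k, k)}. \<forall>x\<in>P. \<not> x < q} = (if k = 1 then {(1, 1)} else {})" by auto
  have c: "real (card (if k = 1 then {(1 :: int, 1 :: int)} else {})) = of_bool (k = 1)" by simp
  let ?a = "\<lambda>q. of_bool (q = (k - 1, k)) + of_bool (q = (k, k + 1)) - 2 * of_bool (q = (k, k)) :: real"
  have "(\<Sum>q\<in>{(k, k)}. toggle P q) - real (card (if k = 1 then {(1 :: int, 1 :: int)} else {})) *\<^sub>R const_one P
      = (\<Sum>q\<in>P. ?a q *\<^sub>R ind P q)"
    by (rule toggle_subset_sum_eq_ind_sum[OF P kP _ _ M]) (auto simp: P_def shifted_staircase_def)
  also have "\<dots> = (\<Sum>q\<in>P. of_bool (q = (k - 1, k)) *\<^sub>R ind P q)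
      + (\<Sum>q\<in>P. of_bool (q = (k, k + 1)) *\<^sub>R ind P q) - 2 *\<^sub>R (\<Sum>q\<in>P. of_bool (q = (k, k)) *\<^sub>R ind P q)"
    by (simp only: scaleR_diff_left scaleR_left_distrib sum_subtractf sum.distrib scaleR_sum_right
        scaleR_scaleR)
  finally show ?thesis unfolding c sum_of_bool_eq_ind[OF fin] by simp
qed

lemma toggleability_bases_shifted_staircase:
  assumes n: "2 \<le> n"
  defines "P \<equiv> shifted_staircase n"
  shows "is_basis
      ({diag_sum P k (toggle P) | k. 1 - n \<le> k \<and> k < 0}
       \<union> {toggle P (k, k) | k. 1 < k \<and> k \<le> n} \<union> {toggle P (1, 1) - const_one P})
      (toggleability_space P)"
    and "is_basis
      ({diag_sum P k (ind P) | k. 1 - n \<le> k \<and> k < 0}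
       \<union> {2 *\<^sub>R ind P (i, i) - ind P (i - 1, i) - ind P (i, i + 1) | i. 1 < i \<and> i < n}
       \<union> {2 *\<^sub>R ind P (1, 1) - ind P (1, 2), 2 *\<^sub>R ind P (n, n) - ind P (n - 1, n)})
      (toggleability_space P)"
proof -
  \<comment> \<open>Negative indices stand for diagonals, positive ones for the points
    \<open>(k, k)\<close>.\<close>
  define K where "K = {1 - n..<0} \<union> {1..n}"
  define S where "S k = (if k < 0 then {p \<in> P. fst p - snd p = k} else {(k, k)})" for k
  define v where "v k = (if k < 0 then diag_sum P k (toggle P)
    else toggle P (k, k) - of_bool (k = 1) *\<^sub>R const_one P)" for k
  define w where "w k = (if k < 0 then diag_sum P k (ind P)
    else 2 *\<^sub>R ind P (k, k) - ind P (k - 1, k) - ind P (k, k + 1))" for k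
  have K: "K = {k. 1 - n \<le> k \<and> k < 0} \<union> {k. 1 < k \<and> k \<le> n} \<union> {1}"
    "K = {k. 1 - n \<le> k \<and> k < 0} \<union> {k. 1 < k \<and> k < n} \<union> {1, n}"
    using n by (auto simp: K_def)
  have "v ` {k. 1 - n \<le> k \<and> k < 0} = {diag_sum P k (toggle P) | k. 1 - n \<le> k \<and> k < 0}"
    "v ` {k. 1 < k \<and> k \<le> n} = {toggle P (k, k) | k. 1 < k \<and> k \<le> n}"
    "v ` {1} = {toggle P (1, 1) - const_one P}"
    by (force simp: v_def)+
  then have V: "v ` K = {diag_sum P k (toggle P) | k. 1 - n \<le> k \<and> k < 0}
       \<union> {toggle P (k, k) | k. 1 < k \<and> k \<le> n} \<union> {toggle P (1, 1) - const_one P}"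
    unfolding K(1) image_Un by (simp only:)
  \<comment> \<open>These points arise from the general formula for \<open>w\<close> at
    \<open>k = 1\<close> and \<open>k = n\<close>.\<close>
  have outside: "ind P (0, 1) = 0" "ind P (n, n + 1) = 0"
    by (auto simp: P_def shifted_staircase_def intro!: ind_outside)
  have "w ` {k. 1 - n \<le> k \<and> k < 0} = {diag_sum P k (ind P) | k. 1 - n \<le> k \<and> k < 0}"
    "w ` {k. 1 < k \<and> k < n} = {2 *\<^sub>R ind P (i, i) - ind P (i - 1, i) - ind P (i, i + 1) | i. 1 < i \<and> i < n}"
    by (force simp: w_def)+
  moreover have "w ` {1, n} = {2 *\<^sub>R ind P (1, 1) - ind P (1, 2), 2 *\<^sub>R ind P (n, n) - ind P (n - 1, n)}"
    using n by (simp add: w_def outside)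
  ultimately have W: "w ` K = {diag_sum P k (ind P) | k. 1 - n \<le> k \<and> k < 0}
       \<union> {2 *\<^sub>R ind P (i, i) - ind P (i - 1, i) - ind P (i, i + 1) | i. 1 < i \<and> i < n}
       \<union> {2 *\<^sub>R ind P (1, 1) - ind P (1, 2), 2 *\<^sub>R ind P (n, n) - ind P (n - 1, n)}"
    unfolding K(2) image_Un by (simp only:)
  \<comment> \<open>The vectors \<open>w i\<close> of the main diagonal add up to twice the diagonal 0 minus twice the diagonal -1.\<close>
  have D0: "diag_sum P 0 (ind P) \<in> span (w ` K)"
  proof -
    have d0: "diag_sum P 0 (ind P) = (\<Sum>i\<in>{1..n}. ind P (i, i))"
      by (rule diag_sum_ind_image) (auto simp: inj_on_def P_def shifted_staircase_def)
    \<comment> \<open>Diagonal -1 has \<open>n - 1\<close> points and is listed in two ways by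
      \<open>1..n\<close>, with the extra point \<open>(0, 1)\<close> here and
      \<open>(n, n + 1)\<close> in \<open>d2\<close>.\<close>
    have d1: "diag_sum P (- 1) (ind P) = (\<Sum>i\<in>{1..n}. ind P (i - 1, i))"
      by (rule diag_sum_ind_image) (auto simp: inj_on_def image_iff P_def shifted_staircase_def)
    have d2: "diag_sum P (- 1) (ind P) = (\<Sum>i\<in>{1..n}. ind P (i, i + 1))"
      by (rule diag_sum_ind_image) (auto simp: inj_on_def image_iff P_def shifted_staircase_def)
    have "(\<Sum>i\<in>{1..n}. w i) = (\<Sum>i\<in>{1..n}. 2 *\<^sub>R ind P (i, i) - ind P (i - 1, i) - ind P (i, i + 1))"
      by (intro sum.cong refl) (simp add: w_def)
    also have "\<dots> = 2 *\<^sub>R diag_sum P 0 (ind P) - diag_sum P (- 1) (ind P) - diag_sum P (- 1) (ind P)"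
      unfolding sum_subtractf d1[symmetric] d2[symmetric] d0 scaleR_sum_right ..
    finally have "2 *\<^sub>R diag_sum P 0 (ind P) = (\<Sum>i\<in>{1..n}. w i) + 2 *\<^sub>R w (- 1)"
      by (simp add: w_def scaleR_2)
    moreover have "(\<Sum>i\<in>{1..n}. w i) + 2 *\<^sub>R w (- 1) \<in> span (w ` K)"
      using n by (intro span_add span_sum span_scale span_base imageI) (auto simp: K_def)
    ultimately have "2 *\<^sub>R diag_sum P 0 (ind P) \<in> span (w ` K)" by (simp only:)
    then have "(1 / 2) *\<^sub>R (2 *\<^sub>R diag_sum P 0 (ind P)) \<in> span (w ` K)" by (rule span_scale)
    then show ?thesis by simp
  qed
  have diag: "diag_sum P k (ind P) \<in> span (w ` K)" if "k \<le> 0" for k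
  proof -
    from that have "k = 0 \<or> (k < 0 \<and> k \<in> K) \<or> k < 1 - n" by (auto simp: K_def)
    then consider "k = 0" | "k < 0" "k \<in> K" | "k < 1 - n" by blast
    then show ?thesis
    proof cases
      case 2
      then have "diag_sum P k (ind P) = w k" by (simp add: w_def)
      then show ?thesis using 2 by (auto intro: span_base)
    next
      case 3
      then have "diag_sum P k (ind P) = 0"
        by (intro diag_sum_eq_0) (auto simp: P_def shifted_staircase_def)
      then show ?thesis by (simp add: span_zero)
    qed (simp add: D0)
  qed
  have "is_basis (v ` K) (toggleability_space P) \<and> is_basis (w ` K) (toggleability_space P)"
  proof (rule toggleability_space_bases)
    show "unit_step_poset P" by (simp add: P_def unit_step_shifted_staircase)
    show "finite K" by (simp add: K_def)
  next
    fix k assume k: "k \<in> K"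
    then have "(if k < 0 then (1, 1 - k) else (k, k)) \<in> S k"
      using n by (auto simp: S_def P_def shifted_staircase_def K_def)
    then show "S k \<noteq> {}" by blast
    show "S k \<subseteq> P" using k by (auto simp: S_def P_def shifted_staircase_def K_def)
    show "v k \<in> span (w ` K)"
    proof (cases "k < 0")
      case True
      then have "v k = diag_sum P (k - 1) (ind P) + diag_sum P (k + 1) (ind P) - 2 *\<^sub>R diag_sum P k (ind P)"
        using diag_toggle_sum_shifted_staircase[OF n, of k] k by (simp add: v_def K_def P_def)
      then show ?thesis using True by (simp add: span_diff span_add span_scale diag)
    next
      case False
      then have "v k = - w k"
        using toggle_diagonal_shifted_staircase[OF n, of k] k by (simp add: v_def w_def K_def P_def)
      then show ?thesis using k by (simp add: span_neg span_base)
    qed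
    show "v k = (\<Sum>q\<in>S k. toggle P q) - of_bool (k = 1) *\<^sub>R const_one P"
      by (simp add: v_def diag_sum_eq S_def)
    show "w k \<in> span (ind P ` P)"
      unfolding w_def by (auto intro!: diag_sum_ind_in_span span_diff span_scale ind_in_span)
  next
    fix b k p q assume bal: "balanced P b" and "k \<in> K" and pq: "p \<in> S k" "q \<in> S k"
    show "b p = b q"
    proof (cases "k < 0")
      case True
      then have "p \<in> P" "fst p - snd p = k" "q \<in> P" "fst q - snd q = k" using pq by (auto simp: S_def)
      then show ?thesis
        by (rule balanced_diag_constant[OF bal, rotated]) (use True in \<open>auto simp: P_def shifted_staircase_def\<close>)
    qed (use pq in \<open>auto simp: S_def\<close>)
  next
    fix b p assume p: "p \<in> P" "\<forall>k\<in>K. p \<notin> S k"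
    obtain i j where ij: "p = (i, j)" by fastforce
    then have "i < j \<or> i = j" using p by (auto simp: P_def shifted_staircase_def)
    then have "p \<in> S (if i < j then i - j else i) \<and> (if i < j then i - j else i) \<in> K"
      using p(1) ij by (auto simp: S_def K_def P_def shifted_staircase_def)
    then show "b p = (0::real)" using p(2) by blast
  next
    fix k l p assume "k \<in> K" "l \<in> K" "p \<in> S k" "p \<in> S l"
    then show "k = l" by (auto simp: S_def K_def split: if_splits)
  qed
  then show "is_basis
      ({diag_sum P k (toggle P) | k. 1 - n \<le> k \<and> k < 0}
       \<union> {toggle P (k, k) | k. 1 < k \<and> k \<le> n} \<union> {toggle P (1, 1) - const_one P})
      (toggleability_space P)"
    "is_basis
      ({diag_sum P k (ind P) | k. 1 - n \<le> k \<and> k < 0}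
       \<union> {2 *\<^sub>R ind P (i, i) - ind P (i - 1, i) - ind P (i, i + 1) | i. 1 < i \<and> i < n}
       \<union> {2 *\<^sub>R ind P (1, 1) - ind P (1, 2), 2 *\<^sub>R ind P (n, n) - ind P (n - 1, n)})
      (toggleability_space P)"
    unfolding V W by blast+
qed

section \<open>The root poset of type A\<close>

lemma diag_toggle_sum_root_poset_A:
  assumes "2 \<le> n" "0 \<le> k" "k \<le> n - 1"
  defines "P \<equiv> root_poset_A n" and "t \<equiv> 2 * k + 1 - n"
  shows "diag_sum P t (toggle P) - const_one P
    = diag_sum P (t - 1) (ind P) + diag_sum P (t + 1) (ind P) - 2 *\<^sub>R diag_sum P t (ind P)"
proof -
  have "(\<forall>x\<in>P. \<not> x < q) \<longleftrightarrow> fst q + snd q = n + 1" if "q \<in> P" for q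
    using minimal_root_poset_A[of "fst q" "snd q" n] that by (simp add: P_def)
  then have "{q \<in> P. fst q - snd q = t \<and> (\<forall>x\<in>P. \<not> x < q)}
      = {q \<in> P. fst q - snd q = t \<and> fst q + snd q = n + 1}" by blast
  also have "\<dots> = {(k + 1, n - k)}" using assms(1-3) by (auto simp: P_def root_poset_A_def t_def)
  finally have M: "{q \<in> P. fst q - snd q = t \<and> (\<forall>x\<in>P. \<not> x < q)} = {(k + 1, n - k)}" .
  \<comment> \<open>The minimal elements satisfy \<open>i + j = n + 1\<close>, so
    \<open>i - j\<close> has the parity of \<open>t\<close>. The two adjacent diagonals therefore
    contain no minimal element.\<close>
  have parity: "i + j \<noteq> n + 1" if "i - j = t - 1 \<or> i - j = t + 1" for i j
    using that unfolding t_def by presburger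
  have "diag_sum P t (toggle P) - real (card {(k + 1, n - k)}) *\<^sub>R const_one P
    = diag_sum P (t - 1) (ind P) + diag_sum P (t + 1) (ind P) - 2 *\<^sub>R diag_sum P t (ind P)"
  proof (rule diag_toggle_sum[OF unit_step_root_poset_A[of n, folded P_def] _ _ _ M])
    fix i j assume "(i, j) \<in> P" "(i + 1, j - 1) \<in> P" "i + 1 - j = t"
    then show "(i + 1, j) \<in> P \<longleftrightarrow> (i, j - 1) \<in> P"
      using parity[of i j] by (auto simp: P_def root_poset_A_def)
  next
    fix i j assume ij: "(i, j) \<in> P" "i - j = t - 1"
    then show "(i + 1, j) \<in> P \<longleftrightarrow> \<not> ((i + 1, j - 1) \<notin> P \<and> (i, j - 1) \<in> P)"
      using parity[of i j] assms(1-3) by (auto simp: P_def root_poset_A_def t_def)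
  next
    fix i j assume ij: "(i, j) \<in> P" "i - j = t + 1"
    then show "(i, j + 1) \<in> P \<longleftrightarrow> \<not> ((i - 1, j + 1) \<notin> P \<and> (i - 1, j) \<in> P)"
      using parity[of i j] assms(1-3) by (auto simp: P_def root_poset_A_def t_def)
  qed
  then show ?thesis by simp
qed

lemma toggleability_bases_root_poset_A:
  assumes n: "2 \<le> n"
  defines "P \<equiv> root_poset_A n"
  shows "is_basis
      {- const_one P + diag_sum P (2 * k + 1 - n) (toggle P) | k. 0 \<le> k \<and> k \<le> n - 1}
      (toggleability_space P)"
    and "is_basis
      {diag_sum P (2 * k + 1 - n) (\<lambda>p. 2 *\<^sub>R ind P p)
         - diag_sum P (2 * k + 2 - n) (ind P) - diag_sum P (2 * k - n) (ind P) | k. 0 \<le> k \<and> k \<le> n - 1}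
      (toggleability_space P)"
proof -
  define K where "K = {0..n - 1}"
  define S where "S k = {p \<in> P. fst p - snd p = 2 * k + 1 - n}" for k
  define v where "v k = - const_one P + diag_sum P (2 * k + 1 - n) (toggle P)" for k
  define w where "w k = diag_sum P (2 * k + 1 - n) (\<lambda>p. 2 *\<^sub>R ind P p)
         - diag_sum P (2 * k + 2 - n) (ind P) - diag_sum P (2 * k - n) (ind P)" for k
  have "is_basis (v ` K) (toggleability_space P) \<and> is_basis (w ` K) (toggleability_space P)"
  proof (rule toggleability_space_bases)
    show "unit_step_poset P" by (simp add: P_def unit_step_root_poset_A)
    show "finite K" by (simp add: K_def)
  next
    fix k assume "k \<in> K"
    then have k: "0 \<le> k" "k \<le> n - 1" by (simp_all add: K_def)
    then have "(k + 1, n - k) \<in> S k" by (auto simp: S_def P_def root_poset_A_def)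
    then show "S k \<noteq> {}" by blast
    have "v k = - w k"
      using diag_toggle_sum_root_poset_A[OF n k]
      by (simp add: v_def w_def P_def diag_sum_scaleR algebra_simps)
    then show "v k \<in> span (w ` K)" using \<open>k \<in> K\<close> by (simp add: span_neg span_base)
    show "v k = (\<Sum>q\<in>S k. toggle P q) - 1 *\<^sub>R const_one P"
      by (simp add: v_def diag_sum_eq S_def)
    show "w k \<in> span (ind P ` P)"
      unfolding w_def diag_sum_scaleR by (intro span_diff span_scale diag_sum_ind_in_span)
  next
    fix b k p q assume bal: "balanced P b" and "k \<in> K" "p \<in> S k" "q \<in> S k"
    then have "p \<in> P" "fst p - snd p = 2 * k + 1 - n" "q \<in> P" "fst q - snd q = 2 * k + 1 - n"
      by (auto simp: S_def)
    then show "b p = b q"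
      by (rule balanced_diag_constant[OF bal, rotated]) (auto simp: P_def root_poset_A_def)
  next
    fix b p assume bal: "balanced P b" and p: "p \<in> P" "\<forall>k\<in>K. p \<notin> S k"
    obtain i j where ij: "p = (i, j)" by fastforce
    \<comment> \<open>The pieces exhaust the diagonals with the parity of the minimal elements; a
      point outside them lies on a diagonal of the other parity, where \<open>balanced_eq_0\<close>
      applies.\<close>
    have "odd (i + j + (n + 1))"
    proof
      assume "even (i + j + (n + 1))"
      then have "even (i - j + n - 1)" by presburger
      then obtain k where "i - j + n - 1 = 2 * k" by (elim evenE)
      then have "p \<in> S k" "k \<in> K" using p(1) ij by (auto simp: S_def K_def P_def root_poset_A_def)
      then show False using p by blast
    qed
    moreover have "(i - 1, j) \<in> P \<and> (i, j - 1) \<in> P" if "(i, j) \<in> P" "odd (i + j + (n + 1))" for i j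
    proof -
      have "i + j \<noteq> n + 1" using that(2) by presburger
      then show ?thesis using that(1) by (auto simp: P_def root_poset_A_def)
    qed
    ultimately show "b p = 0"
      unfolding ij by (intro balanced_eq_0[OF bal, where s = "n + 1"])
        (use p ij in \<open>auto simp: P_def root_poset_A_def\<close>)
  qed (auto simp: S_def)
  moreover have "v ` K = {- const_one P + diag_sum P (2 * k + 1 - n) (toggle P) | k. 0 \<le> k \<and> k \<le> n - 1}"
    by (auto simp: v_def K_def)
  moreover have "w ` K = {diag_sum P (2 * k + 1 - n) (\<lambda>p. 2 *\<^sub>R ind P p)
         - diag_sum P (2 * k + 2 - n) (ind P) - diag_sum P (2 * k - n) (ind P) | k. 0 \<le> k \<and> k \<le> n - 1}"
    by (auto simp: w_def K_def)
  ultimately show "is_basis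
      {- const_one P + diag_sum P (2 * k + 1 - n) (toggle P) | k. 0 \<le> k \<and> k \<le> n - 1}
      (toggleability_space P)"
    "is_basis
      {diag_sum P (2 * k + 1 - n) (\<lambda>p. 2 *\<^sub>R ind P p)
         - diag_sum P (2 * k + 2 - n) (ind P) - diag_sum P (2 * k - n) (ind P) | k. 0 \<le> k \<and> k \<le> n - 1}
      (toggleability_space P)"
    by simp_all
qed

section \<open>The root poset of type B\<close>

text \<open>The parity argument of type A applies, with \<open>(n + k, n - k)\<close> as the single
  minimal element on the diagonal. Since \<open>k > 0\<close>, the lower adjacent diagonal
  \<open>t - 1\<close> stays off the main diagonal.\<close>

lemma diag_toggle_sum_root_poset_B:
  assumes "2 \<le> n" "0 < k" "k \<le> n - 1"
  defines "P \<equiv> root_poset_B n" and "t \<equiv> 2 * k"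
  shows "diag_sum P t (toggle P) - const_one P
    = diag_sum P (t - 1) (ind P) + diag_sum P (t + 1) (ind P) - 2 *\<^sub>R diag_sum P t (ind P)"
proof -
  have "(\<forall>x\<in>P. \<not> x < q) \<longleftrightarrow> fst q + snd q = 2 * n" if "q \<in> P" for q
    using minimal_root_poset_B[of "fst q" "snd q" n] that by (simp add: P_def)
  then have "{q \<in> P. fst q - snd q = t \<and> (\<forall>x\<in>P. \<not> x < q)}
      = {q \<in> P. fst q - snd q = t \<and> fst q + snd q = 2 * n}" by blast
  also have "\<dots> = {(n + k, n - k)}" using assms(1-3) by (auto simp: P_def root_poset_B_def t_def)
  finally have M: "{q \<in> P. fst q - snd q = t \<and> (\<forall>x\<in>P. \<not> x < q)} = {(n + k, n - k)}" .
  have parity: "i + j \<noteq> 2 * n" if "i - j = t - 1 \<or> i - j = t + 1" for i j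
    using that unfolding t_def by presburger
  have "diag_sum P t (toggle P) - real (card {(n + k, n - k)}) *\<^sub>R const_one P
    = diag_sum P (t - 1) (ind P) + diag_sum P (t + 1) (ind P) - 2 *\<^sub>R diag_sum P t (ind P)"
  proof (rule diag_toggle_sum[OF unit_step_root_poset_B[of n, folded P_def] _ _ _ M])
    fix i j assume "(i, j) \<in> P" "(i + 1, j - 1) \<in> P" "i + 1 - j = t"
    then show "(i + 1, j) \<in> P \<longleftrightarrow> (i, j - 1) \<in> P"
      using parity[of i j] by (auto simp: P_def root_poset_B_def)
  next
    fix i j assume ij: "(i, j) \<in> P" "i - j = t - 1"
    then show "(i + 1, j) \<in> P \<longleftrightarrow> \<not> ((i + 1, j - 1) \<notin> P \<and> (i, j - 1) \<in> P)"
      using parity[of i j] assms(1-3) by (auto simp: P_def root_poset_B_def t_def)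
  next
    fix i j assume ij: "(i, j) \<in> P" "i - j = t + 1"
    then show "(i, j + 1) \<in> P \<longleftrightarrow> \<not> ((i - 1, j + 1) \<notin> P \<and> (i - 1, j) \<in> P)"
      using parity[of i j] assms(1-3) by (auto simp: P_def root_poset_B_def t_def)
  qed
  then show ?thesis by simp
qed

text \<open>As in the shifted staircase, each main diagonal toggle is balanced alone, here because
  the corner \<open>(k, k + 1)\<close> of the square above \<open>(k, k)\<close> violates
  \<open>j \<le> i\<close>. Only \<open>(n, n)\<close> is minimal.\<close>

lemma toggle_diagonal_root_poset_B:
  assumes "2 \<le> n" "n \<le> k" "k \<le> 2 * n - 1"
  defines "P \<equiv> root_poset_B n"
  shows "toggle P (k, k) - of_bool (k = n) *\<^sub>R const_one P
    = ind P (k, k - 1) + ind P (k + 1, k) - 2 *\<^sub>R ind P (k, k)"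
proof -
  have P: "unit_step_poset P" by (simp add: P_def unit_step_root_poset_B)
  then have fin: "finite P" by (simp add: unit_step_poset_def)
  have kP: "{(k, k)} \<subseteq> P" using assms by (auto simp: P_def root_poset_B_def)
  then have "(\<forall>x\<in>P. \<not> x < (k, k)) \<longleftrightarrow> k = n"
    using minimal_root_poset_B[of k k n] by (auto simp: P_def)
  then have M: "{q \<in> {(k, k)}. \<forall>x\<in>P. \<not> x < q} = (if k = n then {(n, n)} else {})" by auto
  have c: "real (card (if k = n then {(n, n)} else {})) = of_bool (k = n)" by simp
  let ?a = "\<lambda>q. of_bool (q = (k, k - 1)) + of_bool (q = (k + 1, k)) - 2 * of_bool (q = (k, k)) :: real"
  have "(\<Sum>q\<in>{(k, k)}. toggle P q) - real (card (if k = n then {(n, n)} else {})) *\<^sub>R const_one P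
      = (\<Sum>q\<in>P. ?a q *\<^sub>R ind P q)"
    by (rule toggle_subset_sum_eq_ind_sum[OF P kP _ _ M]) (auto simp: P_def root_poset_B_def)
  also have "\<dots> = (\<Sum>q\<in>P. of_bool (q = (k, k - 1)) *\<^sub>R ind P q)
      + (\<Sum>q\<in>P. of_bool (q = (k + 1, k)) *\<^sub>R ind P q) - 2 *\<^sub>R (\<Sum>q\<in>P. of_bool (q = (k, k)) *\<^sub>R ind P q)"
    by (simp only: scaleR_diff_left scaleR_left_distrib sum_subtractf sum.distrib scaleR_sum_right
        scaleR_scaleR)
  finally show ?thesis unfolding c sum_of_bool_eq_ind[OF fin] by simp
qed

lemma toggleability_bases_root_poset_B:
  assumes n: "2 \<le> n"
  defines "P \<equiv> root_poset_B n"
  shows "is_basis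
      ({- const_one P + diag_sum P (2 * k) (toggle P) | k. 0 < k \<and> k \<le> n - 1}
       \<union> {toggle P (n, n) - const_one P}
       \<union> {toggle P (i, i) | i. n < i \<and> i \<le> 2 * n - 1})
      (toggleability_space P)"
    and "is_basis
      ({diag_sum P (2 * k) (\<lambda>p. 2 *\<^sub>R ind P p)
          - diag_sum P (2 * k - 1) (ind P) - diag_sum P (2 * k + 1) (ind P) | k. 0 < k \<and> k \<le> n - 1}
       \<union> {2 *\<^sub>R ind P (k, k) - ind P (k, k - 1) - ind P (k + 1, k) | k. n < k \<and> k < 2 * n - 1}
       \<union> {2 *\<^sub>R ind P (2 * n - 1, 2 * n - 1) - ind P (2 * n - 1, 2 * n - 2),
          2 *\<^sub>R ind P (n, n) - ind P (n + 1, n)})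
      (toggleability_space P)"
proof -
  \<comment> \<open>Indices below \<open>n\<close> stand for the diagonals
    \<open>i - j = 2 * k\<close>, the others for the points \<open>(k, k)\<close>, which exist
    exactly from \<open>n\<close> to \<open>2 * n - 1\<close>.\<close>
  define K where "K = {1..2 * n - 1}"
  define S where "S k = (if k < n then {p \<in> P. fst p - snd p = 2 * k} else {(k, k)})" for k
  define v where "v k = (if k < n then - const_one P + diag_sum P (2 * k) (toggle P)
    else toggle P (k, k) - of_bool (k = n) *\<^sub>R const_one P)" for k
  define w where "w k = (if k < n then diag_sum P (2 * k) (\<lambda>p. 2 *\<^sub>R ind P p)
      - diag_sum P (2 * k - 1) (ind P) - diag_sum P (2 * k + 1) (ind P)
    else 2 *\<^sub>R ind P (k, k) - ind P (k, k - 1) - ind P (k + 1, k))" for k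
  have K: "K = {k. 0 < k \<and> k \<le> n - 1} \<union> {n} \<union> {k. n < k \<and> k \<le> 2 * n - 1}"
    "K = {k. 0 < k \<and> k \<le> n - 1} \<union> {k. n < k \<and> k < 2 * n - 1} \<union> {2 * n - 1, n}"
    using n by (auto simp: K_def)
  have "v ` {k. 0 < k \<and> k \<le> n - 1} = {- const_one P + diag_sum P (2 * k) (toggle P) | k. 0 < k \<and> k \<le> n - 1}"
    "v ` {n} = {toggle P (n, n) - const_one P}"
    "v ` {k. n < k \<and> k \<le> 2 * n - 1} = {toggle P (i, i) | i. n < i \<and> i \<le> 2 * n - 1}"
    by (force simp: v_def)+
  then have V: "v ` K = {- const_one P + diag_sum P (2 * k) (toggle P) | k. 0 < k \<and> k \<le> n - 1}
       \<union> {toggle P (n, n) - const_one P}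
       \<union> {toggle P (i, i) | i. n < i \<and> i \<le> 2 * n - 1}"
    unfolding K(1) image_Un by (simp only:)
  have outside: "ind P (n, n - 1) = 0" "ind P (2 * n, 2 * n - 1) = 0"
    by (auto simp: P_def root_poset_B_def intro!: ind_outside)
  have "w ` {k. 0 < k \<and> k \<le> n - 1} = {diag_sum P (2 * k) (\<lambda>p. 2 *\<^sub>R ind P p)
          - diag_sum P (2 * k - 1) (ind P) - diag_sum P (2 * k + 1) (ind P) | k. 0 < k \<and> k \<le> n - 1}"
    "w ` {k. n < k \<and> k < 2 * n - 1}
      = {2 *\<^sub>R ind P (k, k) - ind P (k, k - 1) - ind P (k + 1, k) | k. n < k \<and> k < 2 * n - 1}"
    by (force simp: w_def)+
  moreover have "w ` {2 * n - 1, n} = {2 *\<^sub>R ind P (2 * n - 1, 2 * n - 1) - ind P (2 * n - 1, 2 * n - 2),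
          2 *\<^sub>R ind P (n, n) - ind P (n + 1, n)}"
    using n by (simp add: w_def outside)
  ultimately have W: "w ` K = {diag_sum P (2 * k) (\<lambda>p. 2 *\<^sub>R ind P p)
          - diag_sum P (2 * k - 1) (ind P) - diag_sum P (2 * k + 1) (ind P) | k. 0 < k \<and> k \<le> n - 1}
       \<union> {2 *\<^sub>R ind P (k, k) - ind P (k, k - 1) - ind P (k + 1, k) | k. n < k \<and> k < 2 * n - 1}
       \<union> {2 *\<^sub>R ind P (2 * n - 1, 2 * n - 1) - ind P (2 * n - 1, 2 * n - 2),
          2 *\<^sub>R ind P (n, n) - ind P (n + 1, n)}"
    unfolding K(2) image_Un by (simp only:)
  have "is_basis (v ` K) (toggleability_space P) \<and> is_basis (w ` K) (toggleability_space P)"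
  proof (rule toggleability_space_bases)
    show "unit_step_poset P" by (simp add: P_def unit_step_root_poset_B)
    show "finite K" by (simp add: K_def)
  next
    fix k assume k: "k \<in> K"
    then have "(if k < n then (n + k, n - k) else (k, k)) \<in> S k"
      by (auto simp: S_def P_def root_poset_B_def K_def)
    then show "S k \<noteq> {}" by blast
    show "S k \<subseteq> P" using k by (auto simp: S_def P_def root_poset_B_def K_def)
    have "v k = - w k"
    proof (cases "k < n")
      case True
      then show ?thesis
        using diag_toggle_sum_root_poset_B[OF n, of k] k
        by (simp add: v_def w_def K_def P_def diag_sum_scaleR algebra_simps)
    next
      case False
      then show ?thesis
        using toggle_diagonal_root_poset_B[OF n, of k] k by (simp add: v_def w_def K_def P_def)
    qed
    then show "v k \<in> span (w ` K)" using k by (simp add: span_neg span_base)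
    \<comment> \<open>Every even diagonal off the main one contains one minimal element, and so does
      the piece of \<open>(n, n)\<close>; the later diagonal points contain none.\<close>
    show "v k = (\<Sum>q\<in>S k. toggle P q) - of_bool (k \<le> n) *\<^sub>R const_one P"
      by (simp add: v_def diag_sum_eq S_def)
    show "w k \<in> span (ind P ` P)"
      unfolding w_def diag_sum_scaleR
      by (auto intro!: diag_sum_ind_in_span span_diff span_scale ind_in_span)
  next
    fix b k p q assume bal: "balanced P b" and k: "k \<in> K" and pq: "p \<in> S k" "q \<in> S k"
    show "b p = b q"
    proof (cases "k < n")
      case True
      then have "p \<in> P" "fst p - snd p = 2 * k" "q \<in> P" "fst q - snd q = 2 * k"
        using pq by (auto simp: S_def)
      then show ?thesis
        by (rule balanced_diag_constant[OF bal, rotated])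
          (use k in \<open>auto simp: P_def root_poset_B_def K_def\<close>)
    qed (use pq in \<open>auto simp: S_def\<close>)
  next
    fix b p assume bal: "balanced P b" and p: "p \<in> P" "\<forall>k\<in>K. p \<notin> S k"
    obtain i j where ij: "p = (i, j)" by fastforce
    have "odd (i + j + 2 * n)"
    proof
      assume "even (i + j + 2 * n)"
      then have "even (i - j)" by presburger
      then obtain k where k: "i - j = 2 * k" by (elim evenE)
      have "p \<in> S (if i = j then i else k) \<and> (if i = j then i else k) \<in> K"
        using p(1) ij k by (auto simp: S_def K_def P_def root_poset_B_def)
      then show False using p(2) by blast
    qed
    moreover have "(i - 1, j) \<in> P \<and> (i, j - 1) \<in> P" if "(i, j) \<in> P" "odd (i + j + 2 * n)" for i j
    proof -
      \<comment> \<open>Odd parity keeps the point off the minimal antidiagonal and off the main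
        diagonal, so both coordinates can be lowered within \<open>P\<close>.\<close>
      have "i + j \<noteq> 2 * n" "i \<noteq> j" using that(2) by presburger+
      then show ?thesis using that(1) by (auto simp: P_def root_poset_B_def)
    qed
    ultimately show "b p = 0"
      unfolding ij by (intro balanced_eq_0[OF bal, where s = "2 * n"])
        (use p ij in \<open>auto simp: P_def root_poset_B_def\<close>)
  next
    fix k l p assume "k \<in> K" "l \<in> K" "p \<in> S k" "p \<in> S l"
    then show "k = l" by (auto simp: S_def K_def split: if_splits)
  qed
  then show "is_basis
      ({- const_one P + diag_sum P (2 * k) (toggle P) | k. 0 < k \<and> k \<le> n - 1}
       \<union> {toggle P (n, n) - const_one P}
       \<union> {toggle P (i, i) | i. n < i \<and> i \<le> 2 * n - 1})
      (toggleability_space P)"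
    "is_basis
      ({diag_sum P (2 * k) (\<lambda>p. 2 *\<^sub>R ind P p)
          - diag_sum P (2 * k - 1) (ind P) - diag_sum P (2 * k + 1) (ind P) | k. 0 < k \<and> k \<le> n - 1}
       \<union> {2 *\<^sub>R ind P (k, k) - ind P (k, k - 1) - ind P (k + 1, k) | k. n < k \<and> k < 2 * n - 1}
       \<union> {2 *\<^sub>R ind P (2 * n - 1, 2 * n - 1) - ind P (2 * n - 1, 2 * n - 2),
          2 *\<^sub>R ind P (n, n) - ind P (n + 1, n)})
      (toggleability_space P)"
    unfolding V W by blast+
qed

theorem theorem3p13:
  shows
    "(\<forall>m n :: int. m \<ge> 2 \<longrightarrow> n \<ge> 2 \<longrightarrow>
       (let P = rectangle m n; T = toggle P; X = ind P; c = const_one P in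
        is_basis
          ({diag_sum P k T | k. 1 - n \<le> k \<and> k \<le> m - 1 \<and> k \<noteq> 0} \<union> {- c + diag_sum P 0 T})
          (toggleability_space P) \<and>
        is_basis
          {diag_sum P k X | k. 1 - n \<le> k \<and> k \<le> m - 1}
          (toggleability_space P)))
     \<and>
     (\<forall>n :: int. n \<ge> 2 \<longrightarrow>
       (let P = shifted_staircase n; T = toggle P; X = ind P; c = const_one P in
        is_basis
          ({diag_sum P k T | k. 1 - n \<le> k \<and> k < 0}
           \<union> {T (k, k) | k. 1 < k \<and> k \<le> n}
           \<union> {T (1, 1) - c})
          (toggleability_space P) \<and>
        is_basis
          ({diag_sum P k X | k. 1 - n \<le> k \<and> k < 0}
           \<union> {2 *\<^sub>R X (i, i) - X (i - 1, i) - X (i, i + 1) | i. 1 < i \<and> i < n}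
           \<union> {2 *\<^sub>R X (1, 1) - X (1, 2), 2 *\<^sub>R X (n, n) - X (n - 1, n)})
          (toggleability_space P)))
     \<and>
     (\<forall>n :: int. n \<ge> 2 \<longrightarrow>
       (let P = root_poset_A n; T = toggle P; X = ind P; c = const_one P in
        is_basis
          {- c + diag_sum P (2 * k + 1 - n) T | k. 0 \<le> k \<and> k \<le> n - 1}
          (toggleability_space P) \<and>
        is_basis
          {diag_sum P (2 * k + 1 - n) (\<lambda>p. 2 *\<^sub>R X p)
             - diag_sum P (2 * k + 2 - n) X - diag_sum P (2 * k - n) X | k. 0 \<le> k \<and> k \<le> n - 1}
          (toggleability_space P)))
     \<and>
     (\<forall>n :: int. n \<ge> 2 \<longrightarrow>
       (let P = root_poset_B n; T = toggle P; X = ind P; c = const_one P in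
        is_basis
          ({- c + diag_sum P (2 * k) T | k. 0 < k \<and> k \<le> n - 1}
           \<union> {T (n, n) - c}
           \<union> {T (i, i) | i. n < i \<and> i \<le> 2 * n - 1})
          (toggleability_space P) \<and>
        is_basis
          ({diag_sum P (2 * k) (\<lambda>p. 2 *\<^sub>R X p)
              - diag_sum P (2 * k - 1) X - diag_sum P (2 * k + 1) X | k. 0 < k \<and> k \<le> n - 1}
           \<union> {2 *\<^sub>R X (k, k) - X (k, k - 1) - X (k + 1, k) | k. n < k \<and> k < 2 * n - 1}
           \<union> {2 *\<^sub>R X (2 * n - 1, 2 * n - 1) - X (2 * n - 1, 2 * n - 2),
              2 *\<^sub>R X (n, n) - X (n + 1, n)})
          (toggleability_space P)))"
  unfolding Let_def
  by (intro conjI allI impI;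
      rule toggleability_bases_rectangle toggleability_bases_shifted_staircase
        toggleability_bases_root_poset_A toggleability_bases_root_poset_B; assumption)

end
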